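(* Let $A$, $\psi$, $y_0$ and the time steps $\tau_j$ satisfy assumptions (A) listed in the context, and let $(A_\delta)_{\delta>0}$ be a family of functions each satisfying the condition (A)(i) in place of $A$. In addition let $A_\delta'$ be strongly monotone with a constant $C_A$ independent of $\delta$, and let $$|A_\delta'(p)-A'(p)|\le\eta(\delta)\qquad\forall p\in\mathbb{R}^d,\ \delta>0 .$$ Let $y_0$, $u_\tau\in U_\tau$ and $\max_j\tau_j$ be fixed. Let $y_\tau(u_\tau)\in Y_\tau$ be the solution of $$\tfrac{\varepsilon}{\tau_j}(y_j-y_{j-1},\varphi)+\varepsilon(A'(\nabla y_j),\nabla\varphi)+\tfrac1\varepsilon(\psi'(y_j),\varphi)=(u_j,\varphi)\qquad\forall\varphi\in H^1(\Omega),\ j=1,\dots,N,$$ with initial value $y_0$, and let $y_\tau^\delta(u_\tau)\in Y_\tau$ be the solution of the same scheme with $A'$ replaced by $A_\delta'$ and the same initial value $y_0$. Then $$\|y_\tau(u_\tau)-y_\tau^\delta(u_\tau)\|_{L^\infty(0,T;L^2(\Omega))}+\|\nabla y_\tau(u_\tau)-\nabla y_\tau^\delta(u_\tau)\|_{L^2(0,T;L^2(\Omega))}\le C_{A,\psi,T}\,\eta(\delta),$$ where the constant $C_{A,\psi,T}$ depends only on $C_A$, $C_\psi$, $T$, the fixed data $\varepsilon,\Omega$ and $\max_j\tau_j$, and in particular not on $\delta$.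
   Context: $\Omega\subset\mathbb{R}^d$ is a bounded Lipschitz domain, $T>0$, $Q=[0,T]\times\Omega$, $\varepsilon>0$, and $(\cdot,\cdot)$ is the $L^2(\Omega)$ inner product. Let $0=t_0<t_1<\dots<t_N=T$, $\tau_j:=t_j-t_{j-1}$, $I_j:=(t_{j-1},t_j]$. $Y_\tau$ (resp. $U_\tau$) is the space of functions $Q\to\mathbb{R}$ that are constant in time on each $I_j$ with values in $H^1(\Omega)$ (resp. $L^2(\Omega)$); the constant value on $I_j$ is denoted by a subscript, e.g. $y_j:=y_\tau|_{I_j}$. Assumptions (A): (i) $A\in C^1(\mathbb{R}^d)$, its gradient $A'$ is strongly monotone, i.e. $(A'(p)-A'(q))\cdot(p-q)\ge C_A|p-q|^2$ for some $C_A>0$ and all $p,q\in\mathbb{R}^d$, and $|A'(p)|\le C|p|$ for all $p$. (ii) $\psi\in C^1(\mathbb{R})$ is bounded from below and can be approximated by functions $f_n\in C^2(\mathbb{R})$ with $f_n\to\psi$ in $C^1_{\rm loc}$, $-c\le f_n\le c(\psi+1)$, $f_n''\ge -C_\psi$ and $|f_n''|\le C_n$, where $c,C_\psi,C_n\ge0$ are constants. (iii) $y_0\in H^1(\Omega)$ with $\psi(y_0)\in L^1(\Omega)$ is given. (iv) $\max_j\tau_j<\varepsilon^2/C_\psi$ (no restriction if $C_\psi=0$). It is known that under (A) the scheme has a unique solution in $Y_\tau$ for each $u_\tau\in U_\tau$ (both with $A$ and with $A_\delta$). $\eta:(0,\infty)\to[0,\infty)$ is some function. *)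

theory Defs
  imports "HOL-Probability.Essential_Supremum"
begin

subsection \<open>Domains\<close>

text \<open>
  Near every boundary point \<open>\<Omega>\<close> is, in a suitable direction \<open>e\<close>, the strict epigraph of a Lipschitz
  function on the hyperplane orthogonal to \<open>e\<close>; \<open>x - (x \<bullet> e) e\<close> is the orthogonal projection
  of \<open>x\<close> to that hyperplane.
\<close>
definition lipschitz_domain :: "'a::euclidean_space set \<Rightarrow> bool" where
  "lipschitz_domain \<Omega> \<longleftrightarrow>
     open \<Omega> \<and> connected \<Omega> \<and> \<Omega> \<noteq> {} \<and>
     (\<forall>z\<in>frontier \<Omega>. \<exists>r>0. \<exists>e g L. norm e = 1 \<and> L-lipschitz_on {y. y \<bullet> e = 0} g \<and>
        \<Omega> \<inter> ball z r = {x \<in> ball z r. g (x - (x \<bullet> e) *\<^sub>R e) < x \<bullet> e})"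


subsection \<open>Lebesgue and Sobolev spaces\<close>

text \<open>
  Elements of \<open>L\<^sup>2(\<Omega>)\<close> and \<open>H\<^sup>1(\<Omega>)\<close> are represented by functions on the whole space of which only
  the values on \<open>\<Omega>\<close>, up to Lebesgue null sets, matter.
\<close>
definition L2_space :: "'a::euclidean_space set \<Rightarrow> ('a \<Rightarrow> 'b::euclidean_space) set" where
  "L2_space \<Omega> = {f \<in> borel_measurable (lebesgue_on \<Omega>).
                   integrable (lebesgue_on \<Omega>) (\<lambda>x. (norm (f x))\<^sup>2)}"

definition l2_inner ::
    "'a::euclidean_space set \<Rightarrow> ('a \<Rightarrow> 'b::euclidean_space) \<Rightarrow> ('a \<Rightarrow> 'b) \<Rightarrow> real" where
  "l2_inner \<Omega> f g = (LINT x|lebesgue_on \<Omega>. f x \<bullet> g x)"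

definition l2_norm :: "'a::euclidean_space set \<Rightarrow> ('a \<Rightarrow> 'b::euclidean_space) \<Rightarrow> real" where
  "l2_norm \<Omega> f = sqrt (l2_inner \<Omega> f f)"

primrec Ck :: "nat \<Rightarrow> ('a::euclidean_space \<Rightarrow> real) \<Rightarrow> bool" where
  "Ck 0 f \<longleftrightarrow> continuous_on UNIV f"
| "Ck (Suc k) f \<longleftrightarrow> (\<forall>x. f differentiable (at x)) \<and>
     (\<forall>i\<in>Basis. Ck k (\<lambda>x. frechet_derivative f (at x) i))"

definition test_function :: "'a::euclidean_space set \<Rightarrow> ('a \<Rightarrow> real) \<Rightarrow> bool" where
  "test_function \<Omega> \<phi> \<longleftrightarrow> (\<forall>k. Ck k \<phi>) \<and> (\<exists>K. compact K \<and> K \<subseteq> \<Omega> \<and> (\<forall>x. x \<notin> K \<longrightarrow> \<phi> x = 0))"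

definition has_weak_gradient ::
    "'a::euclidean_space set \<Rightarrow> ('a \<Rightarrow> real) \<Rightarrow> ('a \<Rightarrow> 'a) \<Rightarrow> bool" where
  "has_weak_gradient \<Omega> f G \<longleftrightarrow> f \<in> L2_space \<Omega> \<and> G \<in> L2_space \<Omega> \<and>
     (\<forall>\<phi>. test_function \<Omega> \<phi> \<longrightarrow> (\<forall>i\<in>Basis.
        (LINT x|lebesgue_on \<Omega>. f x * frechet_derivative \<phi> (at x) i)
          = - (LINT x|lebesgue_on \<Omega>. (G x \<bullet> i) * \<phi> x)))"

definition H1_space :: "'a::euclidean_space set \<Rightarrow> ('a \<Rightarrow> real) set" where
  "H1_space \<Omega> = {f. \<exists>G. has_weak_gradient \<Omega> f G}"

text \<open>The weak gradient is unique up to null sets; this picks one representative.\<close>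
definition weak_grad :: "'a::euclidean_space set \<Rightarrow> ('a \<Rightarrow> real) \<Rightarrow> 'a \<Rightarrow> 'a" where
  "weak_grad \<Omega> f = (SOME G. has_weak_gradient \<Omega> f G)"


subsection \<open>Functions on the space-time cylinder\<close>

text \<open>
  Functions on \<open>[0,T] \<times> \<Omega>\<close> are curried, time being the first argument. The norms below only see times
  in \<open>(0,T)\<close>. The norm of \<open>L\<^sup>\<infinity>(0,T;L\<^sup>2(\<Omega>))\<close> takes values in the extended reals.
\<close>
definition LinfL2_norm ::
    "real \<Rightarrow> 'a::euclidean_space set \<Rightarrow> (real \<Rightarrow> 'a \<Rightarrow> 'b::euclidean_space) \<Rightarrow> ereal" where
  "LinfL2_norm T \<Omega> v = esssup (lebesgue_on {0<..<T}) (\<lambda>s. ereal (l2_norm \<Omega> (v s)))"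

definition L2L2_norm ::
    "real \<Rightarrow> 'a::euclidean_space set \<Rightarrow> (real \<Rightarrow> 'a \<Rightarrow> 'b::euclidean_space) \<Rightarrow> real" where
  "L2L2_norm T \<Omega> v = sqrt (LINT s|lebesgue_on {0<..<T}. (l2_norm \<Omega> (v s))\<^sup>2)"

definition time_partition :: "real \<Rightarrow> nat \<Rightarrow> (nat \<Rightarrow> real) \<Rightarrow> bool" where
  "time_partition T N t \<longleftrightarrow> 1 \<le> N \<and> t 0 = 0 \<and> t N = T \<and> (\<forall>j\<in>{1..N}. t (j - 1) < t j)"

definition tau :: "(nat \<Rightarrow> real) \<Rightarrow> nat \<Rightarrow> real" where
  "tau t j = t j - t (j - 1)"

text \<open>
  Functions that are constant in time on each \<open>I\<^sub>j = (t\<^sub>j\<^sub>-\<^sub>1, t\<^sub>j]\<close>, as functions into the space \<open>X\<close>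
  of almost-everywhere classes on \<open>\<Omega>\<close>. Since \<open>t\<^sub>j \<in> I\<^sub>j\<close>, the value on \<open>I\<^sub>j\<close> is \<open>v (t j)\<close>.
\<close>
definition step_space ::
    "'a::euclidean_space set \<Rightarrow> nat \<Rightarrow> (nat \<Rightarrow> real) \<Rightarrow> ('a \<Rightarrow> real) set \<Rightarrow> (real \<Rightarrow> 'a \<Rightarrow> real) set" where
  "step_space \<Omega> N t X = {v. \<forall>j\<in>{1..N}. v (t j) \<in> X \<and>
     (\<forall>s\<in>{t (j - 1)<..t j}. AE x in lebesgue_on \<Omega>. v s x = v (t j) x)}"

definition Y_space where "Y_space \<Omega> N t = step_space \<Omega> N t (H1_space \<Omega>)"

definition U_space where "U_space \<Omega> N t = step_space \<Omega> N t (L2_space \<Omega>)"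

definition step_value ::
    "('a \<Rightarrow> real) \<Rightarrow> (nat \<Rightarrow> real) \<Rightarrow> (real \<Rightarrow> 'a \<Rightarrow> real) \<Rightarrow> nat \<Rightarrow> 'a \<Rightarrow> real" where
  "step_value y0 t y j = (if j = 0 then y0 else y (t j))"


subsection \<open>Assumptions on the nonlinearities\<close>

definition assm_A :: "real \<Rightarrow> ('a::euclidean_space \<Rightarrow> real) \<Rightarrow> ('a \<Rightarrow> 'a) \<Rightarrow> bool" where
  "assm_A C\<^sub>A A A' \<longleftrightarrow>
     (\<forall>p. GDERIV A p :> A' p) \<and> continuous_on UNIV A' \<and>
     C\<^sub>A > 0 \<and> (\<forall>p q. (A' p - A' q) \<bullet> (p - q) \<ge> C\<^sub>A * (norm (p - q))\<^sup>2) \<and>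
     (\<exists>C. \<forall>p. norm (A' p) \<le> C * norm p)"

definition assm_psi :: "real \<Rightarrow> (real \<Rightarrow> real) \<Rightarrow> (real \<Rightarrow> real) \<Rightarrow> bool" where
  "assm_psi C\<^sub>\<psi> \<psi> \<psi>' \<longleftrightarrow>
     (\<forall>z. (\<psi> has_real_derivative \<psi>' z) (at z)) \<and> continuous_on UNIV \<psi>' \<and>
     (\<exists>m. \<forall>z. m \<le> \<psi> z) \<and> C\<^sub>\<psi> \<ge> 0 \<and>
     (\<exists>(f :: nat \<Rightarrow> real \<Rightarrow> real) f' f'' (c :: real) (Cn :: nat \<Rightarrow> real).
        c \<ge> 0 \<and> (\<forall>n. Cn n \<ge> 0) \<and>
        (\<forall>n z. (f n has_real_derivative f' n z) (at z) \<and>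
               (f' n has_real_derivative f'' n z) (at z)) \<and>
        (\<forall>n. continuous_on UNIV (f'' n)) \<and>
        (\<forall>K. compact K \<longrightarrow> uniform_limit K f \<psi> sequentially \<and> uniform_limit K f' \<psi>' sequentially) \<and>
        (\<forall>n z. - c \<le> f n z \<and> f n z \<le> c * (\<psi> z + 1)) \<and>
        (\<forall>n z. f'' n z \<ge> - C\<^sub>\<psi> \<and> \<bar>f'' n z\<bar> \<le> Cn n))"


subsection \<open>The implicit time discretisation\<close>

text \<open>
  Being a solution includes that the pairing \<open>(\<psi>'(y\<^sub>j), \<phi>)\<close> is a convergent integral for every \<open>\<phi>\<close>,
  since the Bochner integral of a non-integrable function is \<open>0\<close> by convention; this holds in
  particular if \<open>\<psi>'(y\<^sub>j)\<close> is in \<open>L\<^sup>2(\<Omega>)\<close>. All other pairings are of functions in \<open>L\<^sup>2(\<Omega>)\<close>.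
\<close>
definition solves_scheme ::
    "'a::euclidean_space set \<Rightarrow> real \<Rightarrow> nat \<Rightarrow> (nat \<Rightarrow> real) \<Rightarrow> ('a \<Rightarrow> 'a) \<Rightarrow> (real \<Rightarrow> real) \<Rightarrow>
     ('a \<Rightarrow> real) \<Rightarrow> (real \<Rightarrow> 'a \<Rightarrow> real) \<Rightarrow> (real \<Rightarrow> 'a \<Rightarrow> real) \<Rightarrow> bool" where
  "solves_scheme \<Omega> \<epsilon> N t A' \<psi>' y0 u y \<longleftrightarrow>
     y \<in> Y_space \<Omega> N t \<and>
     (\<forall>j\<in>{1..N}. \<forall>\<phi>\<in>H1_space \<Omega>.
        let yj = step_value y0 t y j; yp = step_value y0 t y (j - 1) in
        integrable (lebesgue_on \<Omega>) (\<lambda>x. \<psi>' (yj x) * \<phi> x) \<and>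
        \<epsilon> / tau t j * l2_inner \<Omega> (\<lambda>x. yj x - yp x) \<phi>
          + \<epsilon> * l2_inner \<Omega> (\<lambda>x. A' (weak_grad \<Omega> yj x)) (weak_grad \<Omega> \<phi>)
          + 1 / \<epsilon> * l2_inner \<Omega> (\<lambda>x. \<psi>' (yj x)) \<phi>
        = l2_inner \<Omega> (u (t j)) \<phi>)"

end

theory Submission
  imports Defs "HOL-Real_Asymp.Real_Asymp"
begin

text \<open>
  Subtract the two schemes and test with the error \<open>e\<^sub>j = y\<^sub>j - y\<^sup>\<delta>\<^sub>j\<close>. Strong monotonicity of \<open>A'\<close> absorbs
  the perturbation, \<open>(A'(p) - A\<^sub>\<delta>'(q)) \<bullet> (p - q) \<ge> C\<^sub>A/2 |p - q|\<^sup>2 - \<eta>\<^sup>2/(2 C\<^sub>A)\<close>, and the lower bound on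
  \<open>f\<^sub>n''\<close> gives \<open>(\<psi>'(a) - \<psi>'(b))(a - b) \<ge> -C\<^sub>\<psi> (a - b)\<^sup>2\<close>. A discrete Gronwall argument, started from \<open>e\<^sub>0 = 0\<close>,
  bounds \<open>\<parallel>e\<^sub>j\<parallel>\<^sup>2 + C\<^sub>A \<Sum>\<^sub>i \<tau>\<^sub>i \<parallel>\<nabla>e\<^sub>i\<parallel>\<^sup>2\<close> by a multiple of \<open>\<eta>\<^sup>2\<close>.

  Testing with \<open>e\<^sub>j\<close> requires that the chosen weak gradient of a difference is the difference of the chosen
  weak gradients, i.e. uniqueness of weak gradients, hence the fundamental lemma of the calculus of
  variations. It is obtained from smooth functions converging boundedly to the indicators of open boxes.
\<close>

subsection \<open>Smooth bump functions\<close>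

text \<open>The power \<open>t ^ m\<close> in the denominator closes the family under
  differentiation up to linear combinations. \<open>bump 0\<close> is the classical smooth function
  that vanishes on the left half-line.\<close>

definition bump :: "nat \<Rightarrow> real \<Rightarrow> real" where
  "bump m t = (if t > 0 then exp (- (1 / t)) / t ^ m else 0)"

text \<open>Exponential decay beats every power of \<open>1 / t\<close>. This limit supplies the
  derivative at the origin in \<open>DERIV_bump\<close>.\<close>

lemma bump_tendsto_0: "(bump m \<longlongrightarrow> 0) (at 0)"
proof -
  have "((\<lambda>t. exp (- (1 / t)) / t ^ m) \<longlongrightarrow> 0) (at_right (0::real))"
    by real_asymp
  then have "(bump m \<longlongrightarrow> 0) (at_right 0)"
    by (rule Lim_transform_eventually) (auto simp: bump_def eventually_at_filter)
  moreover have "(bump m \<longlongrightarrow> 0) (at_left 0)"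
    by (rule Lim_transform_eventually[OF tendsto_const]) (auto simp: bump_def eventually_at_filter)
  ultimately show ?thesis
    by (simp add: filterlim_split_at)
qed

lemma DERIV_bump: "(bump m has_real_derivative bump (m + 2) t - m * bump (m + 1) t) (at t)"
proof -
  consider "t > 0" | "t < 0" | "t = 0" by linarith
  then show ?thesis
  proof cases
    case 1
    have "((\<lambda>t. exp (- (1 / t)) / t ^ m) has_real_derivative
        exp (- (1 / t)) / t ^ (m + 2) - m * (exp (- (1 / t)) / t ^ (m + 1))) (at t)"
      \<comment> \<open>The power rule produces the exponent \<open>m - 1\<close>, which truncates
        at \<open>m = 0\<close>; hence the case split on \<open>m\<close>.\<close>
      using 1 by (auto intro!: derivative_eq_intros) (cases m; auto simp: field_simps power2_eq_square)
    then have "((\<lambda>t. exp (- (1 / t)) / t ^ m) has_real_derivative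
        bump (m + 2) t - m * bump (m + 1) t) (at t)"
      using 1 by (simp add: bump_def)
    then show ?thesis
      by (rule has_field_derivative_transform_within_open[where S="{0<..}"])
         (use 1 in \<open>auto simp: bump_def\<close>)
  next
    case 2
    have "((\<lambda>t. 0::real) has_real_derivative bump (m + 2) t - m * bump (m + 1) t) (at t)"
      using 2 by (simp add: bump_def)
    then show ?thesis
      by (rule has_field_derivative_transform_within_open[where S="{..<0}"])
         (use 2 in \<open>auto simp: bump_def\<close>)
  next
    case 3
    \<comment> \<open>For \<open>h\<close> different from 0 this difference quotient is
      \<open>bump (m + 1) h\<close>, because \<open>bump m 0 = 0\<close>.\<close>
    have "((\<lambda>h. (bump m h - bump m 0) / h) \<longlongrightarrow> 0) (at 0)"
      by (rule Lim_transform_eventually[OF bump_tendsto_0[of "m + 1"]])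
         (auto simp: bump_def eventually_at_filter field_simps)
    then show ?thesis
      by (simp add: 3 DERIV_def bump_def)
  qed
qed

text \<open>
  A class of differentiable functions that contains its own partial derivatives, so that its members
  are smooth.
\<close>
inductive bump_algebra :: "('a::euclidean_space \<Rightarrow> real) \<Rightarrow> bool" where
  const: "bump_algebra (\<lambda>x. c)"
| bump: "bump_algebra (\<lambda>x. bump m (x \<bullet> v + c))"
| add: "bump_algebra f \<Longrightarrow> bump_algebra g \<Longrightarrow> bump_algebra (\<lambda>x. f x + g x)"
| mult: "bump_algebra f \<Longrightarrow> bump_algebra g \<Longrightarrow> bump_algebra (\<lambda>x. f x * g x)"

lemma bump_algebra_has_derivative:
  assumes "bump_algebra f"
  shows "\<exists>f'. (\<forall>x. (f has_derivative f' x) (at x)) \<and> (\<forall>i. bump_algebra (\<lambda>x. f' x i))"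
  using assms
proof induction
  case (const c)
  show ?case
    by (rule exI[of _ "\<lambda>_ _. 0"]) (auto intro: bump_algebra.const)
next
  case (bump m v c)
  show ?case
  proof (intro exI conjI allI)
    fix x i :: 'a
    have 1: "((\<lambda>x. x \<bullet> v + c) has_derivative (\<lambda>h. h \<bullet> v)) (at x)"
      by (auto intro!: derivative_eq_intros)
    \<comment> \<open>The difference in \<open>DERIV_bump\<close> is rewritten as a sum with the
      factor \<open>- real m\<close>, since the class has rules for sums and products only.\<close>
    show "((\<lambda>x. bump m (x \<bullet> v + c)) has_derivative
        (\<lambda>h. h \<bullet> v * (bump (m + 2) (x \<bullet> v + c) + (- real m) * bump (m + 1) (x \<bullet> v + c)))) (at x)"
      using DERIV_compose_FDERIV[OF DERIV_bump 1, of m] by simp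
    show "bump_algebra (\<lambda>x. i \<bullet> v * (bump (m + 2) (x \<bullet> v + c) + (- real m) * bump (m + 1) (x \<bullet> v + c)))"
      by (intro bump_algebra.intros)
  qed
next
  case (add f g)
  then obtain f' g' where "\<forall>x. (f has_derivative f' x) (at x)" "\<forall>i. bump_algebra (\<lambda>x. f' x i)"
      "\<forall>x. (g has_derivative g' x) (at x)" "\<forall>i. bump_algebra (\<lambda>x. g' x i)"
    by blast
  then show ?case
    by (intro exI[of _ "\<lambda>x h. f' x h + g' x h"]) (auto intro: has_derivative_add bump_algebra.intros)
next
  case (mult f g)
  then obtain f' g' where "\<forall>x. (f has_derivative f' x) (at x)" "\<forall>i. bump_algebra (\<lambda>x. f' x i)"
      "\<forall>x. (g has_derivative g' x) (at x)" "\<forall>i. bump_algebra (\<lambda>x. g' x i)"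
    by blast
  with mult.hyps show ?case
    by (intro exI[of _ "\<lambda>x h. f x * g' x h + f' x h * g x"] conjI allI
        has_derivative_mult bump_algebra.add bump_algebra.mult) auto
qed

lemma bump_algebra_Ck: "bump_algebra f \<Longrightarrow> Ck k f"
proof (induction k arbitrary: f)
  case 0
  then show ?case
    using bump_algebra_has_derivative[of f]
    by (auto simp: continuous_on_eq_continuous_within
        intro: has_derivative_continuous[THEN continuous_at_imp_continuous_within])
next
  case (Suc k)
  obtain f' where f': "\<forall>x. (f has_derivative f' x) (at x)" "\<forall>i. bump_algebra (\<lambda>x. f' x i)"
    using bump_algebra_has_derivative[OF Suc.prems] by blast
  then have "frechet_derivative f (at x) = f' x" for x
    by (metis frechet_derivative_at)
  with f' show ?case
    using Suc.IH by (auto simp: differentiable_def)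
qed

lemma bump_algebra_prod:
  "finite I \<Longrightarrow> (\<And>i. i \<in> I \<Longrightarrow> bump_algebra (f i)) \<Longrightarrow> bump_algebra (\<lambda>x. \<Prod>i\<in>I. f i x)"
  by (induction I rule: finite_induct) (auto intro: bump_algebra.intros)

text \<open>
  The shift by \<open>1\<close> makes the support a closed box inside the open one, so that the open box itself may
  touch the boundary of the domain.
\<close>
definition box_bump :: "'a::euclidean_space \<Rightarrow> 'a \<Rightarrow> nat \<Rightarrow> 'a \<Rightarrow> real" where
  "box_bump a b n x = (\<Prod>i\<in>Basis.
     bump 0 (real n * (x \<bullet> i - a \<bullet> i) - 1) * bump 0 (real n * (b \<bullet> i - x \<bullet> i) - 1))"

lemma bump_algebra_box_bump: "bump_algebra (box_bump a b n)"
proof -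
  have 1: "real n * (x \<bullet> i - a \<bullet> i) - 1 = x \<bullet> (real n *\<^sub>R i) + (- real n * (a \<bullet> i) - 1)"
    "real n * (b \<bullet> i - x \<bullet> i) - 1 = x \<bullet> (- real n *\<^sub>R i) + (real n * (b \<bullet> i) - 1)" for x i
    by (auto simp: algebra_simps)
  show ?thesis
    unfolding box_bump_def[abs_def] 1 by (intro bump_algebra_prod bump_algebra.intros) auto
qed

lemma test_function_box_bump:
  assumes "box a b \<subseteq> \<Omega>" "n > 0"
  shows "test_function \<Omega> (box_bump a b n)"
proof -
  \<comment> \<open>A factor \<open>bump 0 (n * s - 1)\<close> is nonzero only for
    \<open>s > 1 / n\<close>, so every face moves inwards by \<open>1 / n\<close>. For small
    \<open>n\<close> the closed box may be empty, and the function is then zero.\<close>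
  let ?K = "cbox (a + (1 / real n) *\<^sub>R One) (b - (1 / real n) *\<^sub>R One)"
  have "?K \<subseteq> box a b"
  proof
    fix x assume x: "x \<in> ?K"
    show "x \<in> box a b"
      unfolding mem_box
    proof
      fix i :: 'a assume i: "i \<in> Basis"
      have "a \<bullet> i + 1 / real n \<le> x \<bullet> i" "x \<bullet> i \<le> b \<bullet> i - 1 / real n"
        using x i by (auto simp: mem_box inner_add_left inner_diff_left)
      moreover have "1 / real n > 0" using assms by simp
      ultimately show "a \<bullet> i < x \<bullet> i \<and> x \<bullet> i < b \<bullet> i" by linarith
    qed
  qed
  moreover have "box_bump a b n x = 0" if "x \<notin> ?K" for x
  proof -
    obtain i where i: "i \<in> Basis" "x \<bullet> i < a \<bullet> i + 1 / real n \<or> b \<bullet> i - 1 / real n < x \<bullet> i"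
      using \<open>x \<notin> ?K\<close> by (auto simp: mem_box inner_add_left inner_diff_left not_le)
    then have "bump 0 (real n * (x \<bullet> i - a \<bullet> i) - 1) * bump 0 (real n * (b \<bullet> i - x \<bullet> i) - 1) = 0"
      using assms(2) by (auto simp: bump_def field_simps)
    then show ?thesis
      unfolding box_bump_def using i(1) by (intro prod_zero) auto
  qed
  ultimately show ?thesis
    unfolding test_function_def using assms(1)
    by (blast intro: bump_algebra_Ck[OF bump_algebra_box_bump] compact_cbox)
qed

lemma bump_0_bounds: "0 \<le> bump 0 t" "bump 0 t \<le> 1"
  by (auto simp: bump_def)

lemma box_bump_bounds: "0 \<le> box_bump a b n x" "box_bump a b n x \<le> 1"
  unfolding box_bump_def
  by (auto intro!: prod_nonneg prod_le_1 mult_nonneg_nonneg mult_le_one simp: bump_0_bounds)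

text \<open>For positive \<open>s\<close> the argument tends to infinity and the exponential to 1;
  for \<open>s \<le> 0\<close> the argument never exceeds \<open>-1\<close>. The limit at
  \<open>s = 0\<close> is thus 0, as an open box requires.\<close>

lemma bump_0_tendsto: "(\<lambda>n. bump 0 (real n * s - 1)) \<longlonglongrightarrow> of_bool (s > 0)"
proof (cases "s > 0")
  case True
  have "(\<lambda>n. exp (- (1 / (real n * s - 1)))) \<longlonglongrightarrow> 1"
    using True by real_asymp
  moreover have "eventually (\<lambda>n. real n * s - 1 > 0) sequentially"
    using True by real_asymp
  ultimately show ?thesis
    using True by (auto simp: bump_def elim!: Lim_transform_eventually eventually_mono)
next
  case False
  then have "\<not> real n * s - 1 > 0" for n
    by (smt (verit) mult_nonneg_nonpos of_nat_0_le_iff)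
  then have "bump 0 (real n * s - 1) = 0" for n
    by (simp add: bump_def)
  with False show ?thesis by simp
qed

lemma box_bump_tendsto: "(\<lambda>n. box_bump a b n x) \<longlonglongrightarrow> indicator (box a b) x"
proof -
  have "(\<lambda>n. box_bump a b n x) \<longlonglongrightarrow>
      (\<Prod>i\<in>Basis. of_bool (x \<bullet> i - a \<bullet> i > 0) * of_bool (b \<bullet> i - x \<bullet> i > 0))"
    unfolding box_bump_def by (intro tendsto_prod tendsto_mult bump_0_tendsto)
  also have "(\<Prod>i\<in>Basis. of_bool (x \<bullet> i - a \<bullet> i > 0) * of_bool (b \<bullet> i - x \<bullet> i > 0))
      = (indicator (box a b) x :: real)"
    by (cases "x \<in> box a b") (auto simp: mem_box intro!: prod.neutral prod_zero)
  finally show ?thesis .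
qed

section \<open>The fundamental lemma of the calculus of variations\<close>

text \<open>Open boxes are stable under intersection and generate the Borel sets, and the Borel sets
  with vanishing integral form a Dynkin system. Hence the integral vanishes over every Borel
  set.\<close>

lemma AE_eq_0_if_integral_box_eq_0:
  fixes f :: "'a::euclidean_space \<Rightarrow> real"
  assumes f: "integrable lebesgue f" and 0: "\<And>a b. (LINT x:box a b|lebesgue. f x) = 0"
  shows "AE x in lebesgue. f x = 0"
proof -
  \<comment> \<open>The generator argument reaches Borel sets only, so \<open>f\<close> is replaced
    by a Borel representative.\<close>
  obtain g where g[measurable]: "g \<in> borel_measurable lborel" and fg: "AE x in lborel. f x = g x"
    using completion_ex_borel_measurable_real f by blast
  have fg': "AE x in lebesgue. f x = g x"
    using fg by (rule AE_completion)
  have g': "integrable lebesgue g"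
    using f fg' g integrable_cong_AE_imp measurable_completion by (metis AE_symmetric)
  then have int: "integrable lborel g"
    using g integrable_completion by blast
  have set_int: "set_integrable lborel A g" if "A \<in> sets borel" for A
    unfolding set_integrable_def using int that by (intro integrable_mult_indicator) auto
  have box: "(LINT x:box a b|lborel. g x) = 0" for a b
  proof -
    have "(LINT x:box a b|lborel. g x) = (LINT x:box a b|lebesgue. g x)"
      unfolding set_lebesgue_integral_def by (rule integral_completion[symmetric]) auto
    also have "\<dots> = (LINT x:box a b|lebesgue. f x)"
      unfolding set_lebesgue_integral_def
    proof (rule integral_cong_AE)
      show "AE x in lebesgue. indicat_real (box a b) x *\<^sub>R g x = indicat_real (box a b) x *\<^sub>R f x"
        using fg' by eventually_elim simp
    qed (rule borel_measurable_scaleR[OF borel_measurable_indicator borel_measurable_integrable];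
        use f g' in simp)+
    finally show ?thesis using 0 by simp
  qed
  have "(LINT x:A|lborel. g x) = 0" if "A \<in> sets borel" for A
  proof -
    let ?G = "range (\<lambda>(a, b). box a b :: 'a set)"
    \<comment> \<open>Closure under complements needs the total integral, obtained by exhausting the
      space with growing boxes.\<close>
    have UNIV: "(LINT x:UNIV|lborel. g x) = 0"
    proof -
      let ?B = "\<lambda>n::nat. box (- (real n *\<^sub>R One)) (real n *\<^sub>R One) :: 'a set"
      have U: "(\<Union>n. ?B n) = UNIV" by (rule UN_box_eq_UNIV)
      have "incseq ?B"
        by (auto simp: incseq_def mem_box; force)
      then have "(\<lambda>n. LINT x:?B n|lborel. g x) \<longlonglongrightarrow> (LINT x:(\<Union>n. ?B n)|lborel. g x)"
        by (intro set_integral_cont_up set_int) auto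
      then show ?thesis
        unfolding box U by (simp add: LIMSEQ_const_iff)
    qed
    have "Int_stable ?G" by (auto simp: Int_stable_def box_Int_box)
    moreover have "?G \<subseteq> Pow UNIV" by simp
    moreover have "A \<in> sigma_sets UNIV ?G" using that by (simp add: borel_eq_box)
    ultimately show ?thesis
    proof (induction rule: sigma_sets_induct_disjoint)
      case (basic A)
      then show ?case using box by auto
    next
      case empty
      then show ?case by (simp add: set_lebesgue_integral_def)
    next
      case (compl A)
      then have "A \<in> sets borel" by (simp add: borel_eq_box)
      then have "(LINT x:A \<union> (UNIV - A)|lborel. g x)
          = (LINT x:A|lborel. g x) + (LINT x:UNIV - A|lborel. g x)"
        by (intro set_integral_Un set_int) auto
      then show ?case using UNIV compl by simp
    next
      case (union A)
      then have [measurable]: "A i \<in> sets borel" for i by (auto simp: borel_eq_box)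
      have "(LINT x:(\<Union>i. A i)|lborel. g x) = (\<Sum>i. LINT x:A i|lborel. g x)"
        using union.hyps(1) by (intro lebesgue_integral_countable_add set_int)
          (auto simp: disjoint_family_on_def)
      then show ?case using union.IH by simp
    qed
  qed
  \<comment> \<open>Both \<open>g\<close> and the zero function are integrable densities with the
    same integral over each Borel set.\<close>
  then have "AE x in lborel. g x = 0"
    by (intro density_unique_real) (auto simp: int)
  then have "AE x in lebesgue. g x = 0"
    by (rule AE_completion)
  with fg' show ?thesis by eventually_elim simp
qed

text \<open>Testing with \<open>box_bump\<close> and passing to the limit by dominated convergence,
  with majorant \<open>\<bar>f x\<bar>\<close>, gives integral zero over every open box inside
  \<Omega>. The preceding lemma then applies locally, and countably many boxes cover
  \<Omega>.\<close>

lemma fundamental_lemma_variations: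
  fixes H :: "'a::euclidean_space \<Rightarrow> real"
  assumes "open \<Omega>" and H: "integrable (lebesgue_on \<Omega>) H"
    and test: "\<And>\<phi>. test_function \<Omega> \<phi> \<Longrightarrow> (LINT x|lebesgue_on \<Omega>. H x * \<phi> x) = 0"
  shows "AE x in lebesgue_on \<Omega>. H x = 0"
proof -
  have [measurable]: "\<Omega> \<in> sets lebesgue" using \<open>open \<Omega>\<close> by auto
  define f where "f x = indicator \<Omega> x * H x" for x
  have f: "integrable lebesgue f"
    using H by (simp add: f_def[abs_def] integrable_restrict_space)
  have box: "(LINT x:box a b|lebesgue. f x) = 0" if "box a b \<subseteq> \<Omega>" for a b
  proof -
    have meas: "box_bump a b n \<in> borel_measurable lebesgue" for n
      using bump_algebra_Ck[OF bump_algebra_box_bump, of 0]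
      by (auto intro!: borel_measurable_continuous_onI measurable_completion)
    have "(\<lambda>n. LINT x|lebesgue. f x * box_bump a b n x) \<longlonglongrightarrow> (LINT x|lebesgue. f x * indicator (box a b) x)"
    proof (rule integral_dominated_convergence)
      show "integrable lebesgue (\<lambda>x. \<bar>f x\<bar>)" using f by simp
      show "AE x in lebesgue. (\<lambda>n. f x * box_bump a b n x) \<longlonglongrightarrow> f x * indicator (box a b) x"
        by (intro always_eventually allI tendsto_intros box_bump_tendsto)
      show "AE x in lebesgue. norm (f x * box_bump a b n x) \<le> \<bar>f x\<bar>" for n
        using box_bump_bounds[of a b n] by (auto simp: abs_mult mult_left_le)
      show "(\<lambda>x. f x * indicator (box a b) x) \<in> borel_measurable lebesgue"
        using f by (intro borel_measurable_times borel_measurable_indicator borel_measurable_integrable[OF f]) auto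
      show "(\<lambda>x. f x * box_bump a b n x) \<in> borel_measurable lebesgue" for n
        by (intro borel_measurable_times meas borel_measurable_integrable[OF f])
    qed
    moreover have "(LINT x|lebesgue. f x * box_bump a b n x) = 0" if "n > 0" for n
      using test[OF test_function_box_bump[OF \<open>box a b \<subseteq> \<Omega>\<close> that]]
      by (simp add: f_def integral_restrict_space mult.assoc)
    then have "(\<lambda>n. LINT x|lebesgue. f x * box_bump a b n x) \<longlonglongrightarrow> 0"
      by (intro tendsto_eventually eventually_mono[OF eventually_gt_at_top[of 0]]) auto
    ultimately have "(LINT x|lebesgue. f x * indicator (box a b) x) = 0"
      by (rule LIMSEQ_unique)
    then show ?thesis by (simp add: set_lebesgue_integral_def mult.commute)
  qed
  \<comment> \<open>Cutting \<open>f\<close> off outside one box inside \<Omega> reduces its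
    integral over an arbitrary box to the intersection, which is again a box inside
    \<Omega>.\<close>
  have AE_box: "AE x in lebesgue. x \<in> box a b \<longrightarrow> f x = 0" if "box a b \<subseteq> \<Omega>" for a b
  proof -
    have "AE x in lebesgue. indicator (box a b) x * f x = 0"
    proof (rule AE_eq_0_if_integral_box_eq_0)
      show "integrable lebesgue (\<lambda>x. indicator (box a b) x * f x)"
        using integrable_mult_indicator[OF _ f, of "box a b"] by simp
      fix c d
      obtain l u where lu: "box a b \<inter> box c d = box l u"
        by (auto simp: box_Int_box)
      then show "(LINT x:box c d|lebesgue. indicator (box a b) x * f x) = 0"
        using box[of l u] that
        by (auto simp: set_lebesgue_integral_def indicator_inter_arith[symmetric] mult.assoc[symmetric] Int_commute)
    qed
    then show ?thesis by eventually_elim (auto simp: indicator_def)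
  qed
  \<comment> \<open>Boxes with rational corners form a countable cover, so the exceptional null sets
    can be united.\<close>
  define a' b' :: "('a \<Rightarrow> real \<times> real) \<Rightarrow> 'a"
    where "a' p = (\<Sum>i\<in>Basis. fst (p i) *\<^sub>R i)" and "b' p = (\<Sum>i\<in>Basis. snd (p i) *\<^sub>R i)" for p
  define I where "I = {p \<in> Basis \<rightarrow>\<^sub>E \<rat> \<times> \<rat>. box (a' p) (b' p) \<subseteq> \<Omega>}"
  have \<Omega>: "\<Omega> = (\<Union>p\<in>I. box (a' p) (b' p))"
    using open_UNION_box[OF \<open>open \<Omega>\<close>] by (simp add: a'_def b'_def I_def)
  have "countable I"
    unfolding I_def by (rule countable_subset[of _ "Basis \<rightarrow>\<^sub>E \<rat> \<times> \<rat>"])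
      (auto intro!: countable_PiE countable_rat)
  then have "AE x in lebesgue. \<forall>p\<in>I. x \<in> box (a' p) (b' p) \<longrightarrow> f x = 0"
    by (subst AE_ball_countable) (auto intro!: AE_box simp: I_def)
  then have "AE x in lebesgue. x \<in> \<Omega> \<longrightarrow> H x = 0"
    by eventually_elim (use \<Omega> in \<open>auto simp: f_def indicator_def split: if_splits\<close>)
  then show ?thesis by (simp add: AE_restrict_space_iff)
qed

subsection \<open>Square-integrable functions and weak gradients\<close>

lemma in_L2_spaceD:
  assumes "f \<in> L2_space \<Omega>"
  shows "f \<in> borel_measurable (lebesgue_on \<Omega>)" "integrable (lebesgue_on \<Omega>) (\<lambda>x. (norm (f x))\<^sup>2)"
  using assms by (auto simp: L2_space_def)

lemma L2_space_dominated:
  assumes "f \<in> borel_measurable (lebesgue_on \<Omega>)" "integrable (lebesgue_on \<Omega>) h"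
    and "\<And>x. (norm (f x))\<^sup>2 \<le> h x"
  shows "f \<in> L2_space \<Omega>"
proof -
  have "integrable (lebesgue_on \<Omega>) (\<lambda>x. (norm (f x))\<^sup>2)"
    using assms(1) by (intro Bochner_Integration.integrable_bound[OF assms(2)])
      (auto intro!: always_eventually order.trans[OF assms(3) abs_ge_self])
  with assms(1) show ?thesis by (simp add: L2_space_def)
qed

lemma L2_space_diff:
  assumes "f \<in> L2_space \<Omega>" "g \<in> L2_space \<Omega>"
  shows "(\<lambda>x. f x - g x) \<in> L2_space \<Omega>"
proof (rule L2_space_dominated)
  show "integrable (lebesgue_on \<Omega>) (\<lambda>x. 2 * (norm (f x))\<^sup>2 + 2 * (norm (g x))\<^sup>2)"
    using in_L2_spaceD(2)[OF assms(1)] in_L2_spaceD(2)[OF assms(2)] by simp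
  \<comment> \<open>Parallelogram identity: the two sides differ by the square of the norm of
    \<open>f x + g x\<close>.\<close>
  show "(norm (f x - g x))\<^sup>2 \<le> 2 * (norm (f x))\<^sup>2 + 2 * (norm (g x))\<^sup>2" for x
    using inner_ge_zero[of "f x + g x"]
    by (simp add: power2_norm_eq_inner inner_simps inner_commute)
qed (use in_L2_spaceD(1)[OF assms(1)] in_L2_spaceD(1)[OF assms(2)] in simp)

lemma integrable_L2_inner:
  assumes "f \<in> L2_space \<Omega>" "g \<in> L2_space \<Omega>"
  shows "integrable (lebesgue_on \<Omega>) (\<lambda>x. f x \<bullet> g x)"
proof (rule Bochner_Integration.integrable_bound)
  show "integrable (lebesgue_on \<Omega>) (\<lambda>x. (norm (f x))\<^sup>2 + (norm (g x))\<^sup>2)"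
    using in_L2_spaceD(2)[OF assms(1)] in_L2_spaceD(2)[OF assms(2)] by simp
  show "AE x in lebesgue_on \<Omega>. norm (f x \<bullet> g x) \<le> norm ((norm (f x))\<^sup>2 + (norm (g x))\<^sup>2)"
  proof (rule always_eventually, rule)
    fix x
    have "\<bar>f x \<bullet> g x\<bar> \<le> norm (f x) * norm (g x)" by (rule Cauchy_Schwarz_ineq2)
    also have "\<dots> \<le> (norm (f x))\<^sup>2 + (norm (g x))\<^sup>2"
      using sum_squares_bound[of "norm (f x)" "norm (g x)"] zero_le_power2[of "norm (f x)"]
        zero_le_power2[of "norm (g x)"] mult_nonneg_nonneg[OF norm_ge_zero[of "f x"] norm_ge_zero[of "g x"]] by linarith
    finally show "norm (f x \<bullet> g x) \<le> norm ((norm (f x))\<^sup>2 + (norm (g x))\<^sup>2)" by simp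
  qed
qed (use in_L2_spaceD(1)[OF assms(1)] in_L2_spaceD(1)[OF assms(2)] in simp)

lemma integrable_L2_mult:
  fixes f g :: "'a::euclidean_space \<Rightarrow> real"
  shows "f \<in> L2_space \<Omega> \<Longrightarrow> g \<in> L2_space \<Omega> \<Longrightarrow> integrable (lebesgue_on \<Omega>) (\<lambda>x. f x * g x)"
  using integrable_L2_inner[of f \<Omega> g] by simp

lemma L2_space_component:
  assumes "f \<in> L2_space \<Omega>" "i \<in> Basis"
  shows "(\<lambda>x. f x \<bullet> i) \<in> L2_space \<Omega>"
proof (rule L2_space_dominated[OF _ in_L2_spaceD(2)[OF assms(1)]])
  show "(norm (f x \<bullet> i))\<^sup>2 \<le> (norm (f x))\<^sup>2" for x
    by (rule power_mono) (use assms(2) Basis_le_norm in auto)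
qed (use in_L2_spaceD(1)[OF assms(1)] in simp)

text \<open>Boundedness of \<Omega> makes its closure compact and its measure finite. Constants,
  test functions and their partial derivatives become admissible in pairings this way.\<close>

lemma L2_space_continuous:
  fixes f :: "'a::euclidean_space \<Rightarrow> 'b::euclidean_space"
  assumes "continuous_on UNIV f" "bounded \<Omega>" "\<Omega> \<in> sets lebesgue"
  shows "f \<in> L2_space \<Omega>"
proof -
  have f: "f \<in> borel_measurable (lebesgue_on \<Omega>)"
    using assms by (meson continuous_imp_measurable_on_sets_lebesgue continuous_on_subset subset_UNIV)
  have "compact (f ` closure \<Omega>)"
    using assms by (intro compact_continuous_image) (auto intro: continuous_on_subset)
  then obtain B where "\<And>x. x \<in> \<Omega> \<Longrightarrow> norm (f x) \<le> B"
    using closure_subset[of \<Omega>] by (fastforce dest!: compact_imp_bounded simp: bounded_iff)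
  then have "integrable (lebesgue_on \<Omega>) (\<lambda>x. (norm (f x))\<^sup>2)"
    using f assms
    by (intro finite_measure.integrable_const_bound[where B="B\<^sup>2"] finite_measure_lebesgue_on
        bounded_set_imp_lmeasurable)
       (auto intro!: AE_I2 power_mono)
  with f show ?thesis by (simp add: L2_space_def)
qed

lemma integrable_L2:
  fixes f :: "'a::euclidean_space \<Rightarrow> real"
  assumes "f \<in> L2_space \<Omega>" "bounded \<Omega>" "\<Omega> \<in> sets lebesgue"
  shows "integrable (lebesgue_on \<Omega>) f"
  using integrable_L2_mult[OF assms(1) L2_space_continuous[of "\<lambda>_. 1"]] assms by simp

lemma l2_norm_power2: "(l2_norm \<Omega> f)\<^sup>2 = l2_inner \<Omega> f f"
  by (simp add: l2_norm_def l2_inner_def integral_nonneg_AE)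

lemma l2_norm_nonneg: "0 \<le> l2_norm \<Omega> f"
  by (simp add: l2_norm_def l2_inner_def integral_nonneg_AE)

text \<open>Completeness of Lebesgue measure yields the measurability of \<open>g\<close>; extension
  by zero carries the question from \<Omega> to the whole space.\<close>

lemma borel_measurable_lebesgue_on_AE:
  fixes f g :: "'a::euclidean_space \<Rightarrow> 'b::euclidean_space"
  assumes "f \<in> borel_measurable (lebesgue_on \<Omega>)" "AE x in lebesgue_on \<Omega>. f x = g x"
    and "\<Omega> \<in> sets lebesgue"
  shows "g \<in> borel_measurable (lebesgue_on \<Omega>)"
proof -
  have "(\<lambda>x. if x \<in> \<Omega> then f x else 0) \<in> borel_measurable lebesgue"
    using assms borel_measurable_if by blast
  then have "(\<lambda>x. if x \<in> \<Omega> then g x else 0) \<in> borel_measurable lebesgue"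
    by (rule borel_measurable_AE) (use assms in \<open>auto simp: AE_restrict_space_iff\<close>)
  then show ?thesis by (rule borel_measurable_if_D)
qed

lemma L2_space_cong_AE:
  assumes "f \<in> L2_space \<Omega>" "AE x in lebesgue_on \<Omega>. f x = g x" "\<Omega> \<in> sets lebesgue"
  shows "g \<in> L2_space \<Omega>"
proof -
  have g: "g \<in> borel_measurable (lebesgue_on \<Omega>)"
    using borel_measurable_lebesgue_on_AE assms in_L2_spaceD(1) by blast
  have "integrable (lebesgue_on \<Omega>) (\<lambda>x. (norm (g x))\<^sup>2)"
    by (rule integrable_cong_AE_imp[OF in_L2_spaceD(2)[OF assms(1)]]) (use g assms(2) in auto)
  with g show ?thesis by (simp add: L2_space_def)
qed

lemma l2_inner_cong_AE:
  assumes "f \<in> L2_space \<Omega>" "g \<in> L2_space \<Omega>" "\<Omega> \<in> sets lebesgue"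
    and "AE x in lebesgue_on \<Omega>. f x = f' x" "AE x in lebesgue_on \<Omega>. g x = g' x"
  shows "l2_inner \<Omega> f g = l2_inner \<Omega> f' g'"
proof -
  have "f' \<in> L2_space \<Omega>" "g' \<in> L2_space \<Omega>"
    using assms L2_space_cong_AE by blast+
  with assms(1,2) show ?thesis
    unfolding l2_inner_def using assms(4,5)
    by (intro integral_cong_AE) (auto dest!: in_L2_spaceD(1))
qed

lemma l2_inner_diff_left:
  assumes "f \<in> L2_space \<Omega>" "g \<in> L2_space \<Omega>" "h \<in> L2_space \<Omega>"
  shows "l2_inner \<Omega> (\<lambda>x. f x - g x) h = l2_inner \<Omega> f h - l2_inner \<Omega> g h"
  unfolding l2_inner_def inner_diff_left using assms
  by (intro Bochner_Integration.integral_diff integrable_L2_inner)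

section \<open>Weak gradients: differences, uniqueness, dependence on a.e. classes\<close>

lemma test_function_L2:
  assumes "test_function \<Omega> \<phi>" "bounded \<Omega>" "\<Omega> \<in> sets lebesgue"
  shows "\<phi> \<in> L2_space \<Omega>"
  using assms by (intro L2_space_continuous) (auto simp: test_function_def dest: spec[of _ 0])

lemma test_function_derivative_L2:
  assumes "test_function \<Omega> \<phi>" "bounded \<Omega>" "\<Omega> \<in> sets lebesgue" "i \<in> Basis"
  shows "(\<lambda>x. frechet_derivative \<phi> (at x) i) \<in> L2_space \<Omega>"
  using assms by (intro L2_space_continuous) (auto simp: test_function_def dest: spec[of _ "Suc 0"])

lemma has_weak_gradient_diff:
  assumes f: "has_weak_gradient \<Omega> f F" and g: "has_weak_gradient \<Omega> g G"
    and \<Omega>: "bounded \<Omega>" "\<Omega> \<in> sets lebesgue"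
  shows "has_weak_gradient \<Omega> (\<lambda>x. f x - g x) (\<lambda>x. F x - G x)"
  unfolding has_weak_gradient_def
proof (intro conjI allI impI ballI)
  have L2: "f \<in> L2_space \<Omega>" "F \<in> L2_space \<Omega>" "g \<in> L2_space \<Omega>" "G \<in> L2_space \<Omega>"
    using f g by (auto simp: has_weak_gradient_def)
  then show "(\<lambda>x. f x - g x) \<in> L2_space \<Omega>" "(\<lambda>x. F x - G x) \<in> L2_space \<Omega>"
    by (auto intro: L2_space_diff)
  fix \<phi> and i :: 'a assume \<phi>: "test_function \<Omega> \<phi>" and i: "i \<in> Basis"
  note int = integrable_L2_mult test_function_L2[OF \<phi> \<Omega>] test_function_derivative_L2[OF \<phi> \<Omega> i]
    L2_space_component[OF _ i] L2
  show "(LINT x|lebesgue_on \<Omega>. (f x - g x) * frechet_derivative \<phi> (at x) i)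
      = - (LINT x|lebesgue_on \<Omega>. ((F x - G x) \<bullet> i) * \<phi> x)"
    using f g \<phi> i
    by (simp add: has_weak_gradient_def left_diff_distrib inner_diff_left
        Bochner_Integration.integral_diff int)
qed

text \<open>Each component of \<open>F x - G x\<close> integrates to zero against all test
  functions, so the scalar fundamental lemma applies to each of the finitely many
  components.\<close>

lemma has_weak_gradient_unique:
  assumes f: "has_weak_gradient \<Omega> f F" "has_weak_gradient \<Omega> f G" and \<Omega>: "bounded \<Omega>" "open \<Omega>"
  shows "AE x in lebesgue_on \<Omega>. F x = G x"
proof -
  have [measurable]: "\<Omega> \<in> sets lebesgue" using \<Omega> by auto
  have L2: "F \<in> L2_space \<Omega>" "G \<in> L2_space \<Omega>"
    using f by (auto simp: has_weak_gradient_def)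
  have "AE x in lebesgue_on \<Omega>. \<forall>i\<in>Basis. (F x - G x) \<bullet> i = 0"
  proof (rule AE_finite_allI)
    fix i :: 'a assume i: "i \<in> Basis"
    show "AE x in lebesgue_on \<Omega>. (F x - G x) \<bullet> i = 0"
    proof (rule fundamental_lemma_variations[OF \<Omega>(2)])
      show "integrable (lebesgue_on \<Omega>) (\<lambda>x. (F x - G x) \<bullet> i)"
        using L2 \<Omega> i by (intro integrable_L2 L2_space_component L2_space_diff) auto
      fix \<phi> assume \<phi>: "test_function \<Omega> \<phi>"
      have "(LINT x|lebesgue_on \<Omega>. (F x \<bullet> i) * \<phi> x) = (LINT x|lebesgue_on \<Omega>. (G x \<bullet> i) * \<phi> x)"
        using f \<phi> i by (simp add: has_weak_gradient_def)
      then show "(LINT x|lebesgue_on \<Omega>. ((F x - G x) \<bullet> i) * \<phi> x) = 0"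
        using L2 i \<Omega> \<phi>
        by (simp add: left_diff_distrib inner_diff_left Bochner_Integration.integral_diff
            integrable_L2_mult test_function_L2 L2_space_component)
    qed
  qed auto
  then show ?thesis
    by eventually_elim (subst euclidean_eq_iff, simp add: inner_diff_left)
qed

lemma has_weak_gradient_weak_grad:
  "f \<in> H1_space \<Omega> \<Longrightarrow> has_weak_gradient \<Omega> f (weak_grad \<Omega> f)"
  unfolding H1_space_def weak_grad_def using someI_ex[of "has_weak_gradient \<Omega> f"] by simp

lemma H1_space_imp_L2: "f \<in> H1_space \<Omega> \<Longrightarrow> f \<in> L2_space \<Omega>"
  by (auto simp: H1_space_def has_weak_gradient_def)

lemma weak_grad_L2: "f \<in> H1_space \<Omega> \<Longrightarrow> weak_grad \<Omega> f \<in> L2_space \<Omega>"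
  using has_weak_gradient_weak_grad has_weak_gradient_def by blast

lemma H1_space_diff:
  assumes "f \<in> H1_space \<Omega>" "g \<in> H1_space \<Omega>" "bounded \<Omega>" "\<Omega> \<in> sets lebesgue"
  shows "(\<lambda>x. f x - g x) \<in> H1_space \<Omega>"
  using has_weak_gradient_diff[OF assms(1,2)[THEN has_weak_gradient_weak_grad] assms(3,4)]
  by (auto simp: H1_space_def)

text \<open>\<open>weak_grad\<close> selects a representative, so it respects differences only up to
  null sets. This is what permits the error itself as a test function.\<close>

lemma weak_grad_diff:
  assumes "f \<in> H1_space \<Omega>" "g \<in> H1_space \<Omega>" "bounded \<Omega>" "open \<Omega>"
  shows "AE x in lebesgue_on \<Omega>. weak_grad \<Omega> (\<lambda>x. f x - g x) x = weak_grad \<Omega> f x - weak_grad \<Omega> g x"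
  by (rule has_weak_gradient_unique[OF has_weak_gradient_weak_grad[OF H1_space_diff]
        has_weak_gradient_diff[OF assms(1,2)[THEN has_weak_gradient_weak_grad]]])
     (use assms in auto)

lemma has_weak_gradient_cong_AE:
  assumes f: "has_weak_gradient \<Omega> f F" and fg: "AE x in lebesgue_on \<Omega>. f x = g x"
    and \<Omega>: "bounded \<Omega>" "\<Omega> \<in> sets lebesgue"
  shows "has_weak_gradient \<Omega> g F"
  unfolding has_weak_gradient_def
proof (intro conjI allI impI ballI)
  have L2: "f \<in> L2_space \<Omega>" "F \<in> L2_space \<Omega>"
    using f by (auto simp: has_weak_gradient_def)
  then show "g \<in> L2_space \<Omega>" "F \<in> L2_space \<Omega>"
    using L2_space_cong_AE fg \<Omega> by blast+
  fix \<phi> and i :: 'a assume \<phi>: "test_function \<Omega> \<phi>" and i: "i \<in> Basis"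
  have "(LINT x|lebesgue_on \<Omega>. g x * frechet_derivative \<phi> (at x) i)
      = (LINT x|lebesgue_on \<Omega>. f x * frechet_derivative \<phi> (at x) i)"
    using l2_inner_cong_AE[OF L2(1) test_function_derivative_L2[OF \<phi> \<Omega> i] \<Omega>(2) fg AE_I2]
    by (simp add: l2_inner_def)
  also have "\<dots> = - (LINT x|lebesgue_on \<Omega>. (F x \<bullet> i) * \<phi> x)"
    using f \<phi> i by (simp add: has_weak_gradient_def)
  finally show "(LINT x|lebesgue_on \<Omega>. g x * frechet_derivative \<phi> (at x) i)
      = - (LINT x|lebesgue_on \<Omega>. (F x \<bullet> i) * \<phi> x)" .
qed

text \<open>Both functions have exactly the same weak gradients, so \<open>SOME\<close> selects
  literally the same one: the equality holds everywhere.\<close>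

lemma weak_grad_cong_AE:
  assumes "AE x in lebesgue_on \<Omega>. f x = g x" "bounded \<Omega>" "\<Omega> \<in> sets lebesgue"
  shows "weak_grad \<Omega> f = weak_grad \<Omega> g"
proof -
  have "AE x in lebesgue_on \<Omega>. g x = f x" using assms(1) by eventually_elim simp
  then have "has_weak_gradient \<Omega> f G \<longleftrightarrow> has_weak_gradient \<Omega> g G" for G
    using has_weak_gradient_cong_AE assms by blast
  then show ?thesis by (simp add: weak_grad_def)
qed

subsection \<open>Energy estimate\<close>

text \<open>\<open>\<psi>\<close> is only continuously differentiable, so the mean value theorem is
  applied to \<open>f' n\<close>; the bound does not depend on \<open>n\<close> and survives the
  pointwise limit of \<open>f' n\<close>.\<close>

lemma assm_psi_one_sided_Lipschitz:
  assumes "assm_psi C \<psi> \<psi>'"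
  shows "(\<psi>' a - \<psi>' b) * (a - b) \<ge> - C * (a - b)\<^sup>2"
proof -
  obtain f f' f'' where *:
    "\<forall>n z. (f n has_real_derivative f' n z) (at z) \<and> (f' n has_real_derivative f'' n z) (at z)"
    "\<forall>K. compact K \<longrightarrow> uniform_limit K f \<psi> sequentially \<and> uniform_limit K f' \<psi>' sequentially"
    "\<exists>Cn::nat \<Rightarrow> real. \<forall>n z. f'' n z \<ge> - C \<and> \<bar>f'' n z\<bar> \<le> Cn n"
    using assms unfolding assm_psi_def by (elim conjE exE) (rule that, assumption, assumption, rule exI, assumption)
  have d: "(f' n has_real_derivative f'' n z) (at z)" and C: "f'' n z \<ge> - C" for n z
    using * by auto
  have lim: "uniform_limit K f' \<psi>' sequentially" if "compact K" for K
    using * that by auto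
  have conv: "(\<lambda>n. f' n z) \<longlonglongrightarrow> \<psi>' z" for z
    using tendsto_uniform_limitI[OF lim[of "{z}"]] by simp
  have mono: "(f' n a - f' n b) * (a - b) \<ge> - C * (a - b)\<^sup>2" for n
  proof -
    have *: "f' n y - f' n x \<ge> - C * (y - x)" if "x \<le> y" for x y
    proof (rule ccontr)
      assume neg: "\<not> ?thesis"
      then have "x < y" using that by (cases "x = y") auto
      then obtain z where "f' n y - f' n x = (y - x) * f'' n z"
        using MVT2[of x y "f' n" "f'' n"] d by blast
      then show False
        using neg C[of n z] \<open>x < y\<close> mult_left_mono[of "- C" "f'' n z" "y - x"] by (simp add: mult.commute)
    qed
    show ?thesis
    proof (cases "b \<le> a")
      case True
      then show ?thesis
        using mult_right_mono[OF *[of b a], of "a - b"] by (simp add: power2_eq_square algebra_simps)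
    next
      case False
      then show ?thesis
        using mult_right_mono[OF *[of a b], of "b - a"] by (simp add: power2_eq_square algebra_simps)
    qed
  qed
  have "(\<lambda>n. (f' n a - f' n b) * (a - b)) \<longlonglongrightarrow> (\<psi>' a - \<psi>' b) * (a - b)"
    by (intro tendsto_intros conv)
  then show ?thesis
    by (rule LIMSEQ_le_const) (use mono in blast)
qed

text \<open>Linear growth of \<open>A'\<close> dominates the square, so the flux pairs with
  gradients in a convergent integral.\<close>

lemma assm_A_comp_L2:
  assumes "assm_A C A A'" "f \<in> L2_space \<Omega>"
  shows "(\<lambda>x. A' (f x)) \<in> L2_space \<Omega>"
proof -
  obtain K where "continuous_on UNIV A'" and K: "\<And>p. norm (A' p) \<le> K * norm p"
    using assms(1) by (auto simp: assm_A_def)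
  then have "A' \<in> borel_measurable borel" by (simp add: borel_measurable_continuous_onI)
  then have "(\<lambda>x. A' (f x)) \<in> borel_measurable (lebesgue_on \<Omega>)"
    using in_L2_spaceD(1)[OF assms(2)] by (rule measurable_compose[rotated])
  moreover have "(norm (A' (f x)))\<^sup>2 \<le> K\<^sup>2 * (norm (f x))\<^sup>2" for x
    using power_mono[OF K norm_ge_zero, of "f x" 2] by (simp add: power_mult_distrib)
  ultimately show ?thesis
    using in_L2_spaceD(2)[OF assms(2)] by (intro L2_space_dominated[where h="\<lambda>x. K\<^sup>2 * (norm (f x))\<^sup>2"]) auto
qed

text \<open>Split \<open>A p - B q\<close> into \<open>(A p - A q) - (B q - A q)\<close>; Young's
  inequality for the second part spends half of the monotonicity constant.\<close>

lemma perturbed_monotonicity: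
  fixes p q :: "'a::euclidean_space"
  assumes "C > 0" and "(A p - A q) \<bullet> (p - q) \<ge> C * (norm (p - q))\<^sup>2" and "norm (B q - A q) \<le> h"
  shows "(A p - B q) \<bullet> (p - q) \<ge> C / 2 * (norm (p - q))\<^sup>2 - h\<^sup>2 / (2 * C)"
proof -
  have "(B q - A q) \<bullet> (p - q) \<le> norm (B q - A q) * norm (p - q)"
    by (rule norm_cauchy_schwarz)
  also have "\<dots> \<le> h * norm (p - q)"
    by (intro mult_right_mono assms) auto
  also have "\<dots> \<le> C / 2 * (norm (p - q))\<^sup>2 + h\<^sup>2 / (2 * C)"
  proof -
    have "0 \<le> (C * norm (p - q) - h)\<^sup>2 / (2 * C)" using assms(1) by simp
    also have "\<dots> = C / 2 * (norm (p - q))\<^sup>2 + h\<^sup>2 / (2 * C) - h * norm (p - q)"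
      using assms(1) by (simp add: power2_eq_square field_simps)
    finally show ?thesis by simp
  qed
  finally show ?thesis using assms(2) by (simp add: inner_diff_left)
qed

lemma l2_norm_power2_eq_integral: "(l2_norm \<Omega> f)\<^sup>2 = (LINT x|lebesgue_on \<Omega>. (norm (f x))\<^sup>2)"
  by (simp add: l2_norm_power2 l2_inner_def power2_norm_eq_inner)

text \<open>Subtracting the equations cancels the common load \<open>r\<close>. The remaining
  nonlinear terms have pointwise lower bounds, whose integrals give the estimate; the constant part
  of the gradient bound contributes the measure of \<Omega>.\<close>

lemma energy_estimate:
  fixes \<Omega> :: "'a::euclidean_space set"
  assumes \<Omega>: "open \<Omega>" "bounded \<Omega>" and "\<epsilon> > 0" and "C\<^sub>A > 0"
    and H1: "yj \<in> H1_space \<Omega>" "yp \<in> H1_space \<Omega>" "zj \<in> H1_space \<Omega>" "zp \<in> H1_space \<Omega>"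
    and A: "assm_A C\<^sub>A A A'" and B: "assm_A C\<^sub>A B B'" and \<psi>: "assm_psi C\<^sub>\<psi> \<psi> \<psi>'"
    and AB: "\<And>p. norm (B' p - A' p) \<le> h"
  defines "e \<equiv> \<lambda>x. yj x - zj x" and "g \<equiv> \<lambda>x. weak_grad \<Omega> yj x - weak_grad \<Omega> zj x"
  assumes int: "integrable (lebesgue_on \<Omega>) (\<lambda>x. \<psi>' (yj x) * e x)"
      "integrable (lebesgue_on \<Omega>) (\<lambda>x. \<psi>' (zj x) * e x)"
    and eq_y: "\<epsilon> / \<tau> * l2_inner \<Omega> (\<lambda>x. yj x - yp x) e
          + \<epsilon> * l2_inner \<Omega> (\<lambda>x. A' (weak_grad \<Omega> yj x)) (weak_grad \<Omega> e)
          + 1 / \<epsilon> * l2_inner \<Omega> (\<lambda>x. \<psi>' (yj x)) e = r"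
    and eq_z: "\<epsilon> / \<tau> * l2_inner \<Omega> (\<lambda>x. zj x - zp x) e
          + \<epsilon> * l2_inner \<Omega> (\<lambda>x. B' (weak_grad \<Omega> zj x)) (weak_grad \<Omega> e)
          + 1 / \<epsilon> * l2_inner \<Omega> (\<lambda>x. \<psi>' (zj x)) e = r"
  shows "\<epsilon> / \<tau> * l2_inner \<Omega> (\<lambda>x. e x - (yp x - zp x)) e
    + \<epsilon> * (C\<^sub>A / 2 * (l2_norm \<Omega> g)\<^sup>2 - h\<^sup>2 / (2 * C\<^sub>A) * measure lebesgue \<Omega>)
    - C\<^sub>\<psi> / \<epsilon> * (l2_norm \<Omega> e)\<^sup>2 \<le> 0"
proof -
  have [measurable]: "\<Omega> \<in> sets lebesgue" using \<Omega> by auto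
  note L2 = H1[THEN H1_space_imp_L2]
  note G = H1(1,3)[THEN weak_grad_L2]
  have eH: "e \<in> H1_space \<Omega>"
    unfolding e_def using H1 \<Omega> by (intro H1_space_diff) auto
  note e = H1_space_imp_L2[OF eH]
  have g: "g \<in> L2_space \<Omega>" unfolding g_def by (intro L2_space_diff G)
  have ge: "AE x in lebesgue_on \<Omega>. weak_grad \<Omega> e x = g x"
    unfolding e_def g_def using H1 \<Omega> by (intro weak_grad_diff)
  note AG = assm_A_comp_L2[OF A G(1)] and BG = assm_A_comp_L2[OF B G(2)]
  have 1: "l2_inner \<Omega> (\<lambda>x. e x - (yp x - zp x)) e
      = l2_inner \<Omega> (\<lambda>x. yj x - yp x) e - l2_inner \<Omega> (\<lambda>x. zj x - zp x) e"
    using L2 e by (subst l2_inner_diff_left[symmetric]) (auto intro!: L2_space_diff simp: e_def algebra_simps)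
  have "C\<^sub>A / 2 * (l2_norm \<Omega> g)\<^sup>2 - h\<^sup>2 / (2 * C\<^sub>A) * measure lebesgue \<Omega>
      = (LINT x|lebesgue_on \<Omega>. C\<^sub>A / 2 * (norm (g x))\<^sup>2 - h\<^sup>2 / (2 * C\<^sub>A))"
  proof -
    have "\<Omega> \<in> lmeasurable" using \<Omega> by (simp add: bounded_set_imp_lmeasurable)
    then interpret finite_measure "lebesgue_on \<Omega>" by (rule finite_measure_lebesgue_on)
    show ?thesis
      using in_L2_spaceD(2)[OF g] unfolding l2_norm_power2_eq_integral
      by (subst Bochner_Integration.integral_diff)
        (auto simp: measure_restrict_space)
  qed
  also have "\<dots> \<le> (LINT x|lebesgue_on \<Omega>. (A' (weak_grad \<Omega> yj x) - B' (weak_grad \<Omega> zj x)) \<bullet> g x)"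
  proof (rule integral_mono)
    have "\<Omega> \<in> lmeasurable" using \<Omega> by (simp add: bounded_set_imp_lmeasurable)
    then interpret finite_measure "lebesgue_on \<Omega>" by (rule finite_measure_lebesgue_on)
    show "integrable (lebesgue_on \<Omega>) (\<lambda>x. C\<^sub>A / 2 * (norm (g x))\<^sup>2 - h\<^sup>2 / (2 * C\<^sub>A))"
      using in_L2_spaceD(2)[OF g] by simp
    show "integrable (lebesgue_on \<Omega>) (\<lambda>x. (A' (weak_grad \<Omega> yj x) - B' (weak_grad \<Omega> zj x)) \<bullet> g x)"
      by (intro integrable_L2_inner L2_space_diff AG BG g)
    fix x
    show "C\<^sub>A / 2 * (norm (g x))\<^sup>2 - h\<^sup>2 / (2 * C\<^sub>A)
        \<le> (A' (weak_grad \<Omega> yj x) - B' (weak_grad \<Omega> zj x)) \<bullet> g x"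
      unfolding g_def using A AB \<open>C\<^sub>A > 0\<close>
      by (intro perturbed_monotonicity) (auto simp: assm_A_def)
  qed
  also have "\<dots> = l2_inner \<Omega> (\<lambda>x. A' (weak_grad \<Omega> yj x)) g - l2_inner \<Omega> (\<lambda>x. B' (weak_grad \<Omega> zj x)) g"
    unfolding l2_inner_diff_left[OF AG BG g, symmetric] by (simp add: l2_inner_def)
  \<comment> \<open>Uniqueness of weak gradients enters here: \<open>g\<close> and
    \<open>weak_grad \<Omega> e\<close> agree almost everywhere.\<close>
  also have "\<dots> = l2_inner \<Omega> (\<lambda>x. A' (weak_grad \<Omega> yj x)) (weak_grad \<Omega> e)
      - l2_inner \<Omega> (\<lambda>x. B' (weak_grad \<Omega> zj x)) (weak_grad \<Omega> e)"
    using l2_inner_cong_AE[OF AG weak_grad_L2[OF eH] _ AE_I2 ge]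
      l2_inner_cong_AE[OF BG weak_grad_L2[OF eH] _ AE_I2 ge] by simp
  finally have 2: "C\<^sub>A / 2 * (l2_norm \<Omega> g)\<^sup>2 - h\<^sup>2 / (2 * C\<^sub>A) * measure lebesgue \<Omega> \<le> \<dots>" .
  have "- C\<^sub>\<psi> * (l2_norm \<Omega> e)\<^sup>2 = (LINT x|lebesgue_on \<Omega>. - C\<^sub>\<psi> * (norm (e x))\<^sup>2)"
    by (simp add: l2_norm_power2_eq_integral)
  also have "\<dots> \<le> (LINT x|lebesgue_on \<Omega>. \<psi>' (yj x) * e x - \<psi>' (zj x) * e x)"
  proof (rule integral_mono)
    show "integrable (lebesgue_on \<Omega>) (\<lambda>x. - C\<^sub>\<psi> * (norm (e x))\<^sup>2)"
      by (intro integrable_mult_right in_L2_spaceD(2)[OF e])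
    show "- C\<^sub>\<psi> * (norm (e x))\<^sup>2 \<le> \<psi>' (yj x) * e x - \<psi>' (zj x) * e x" for x
      using assm_psi_one_sided_Lipschitz[OF \<psi>, of "zj x" "yj x"] 
      by (simp add: e_def algebra_simps power2_commute[of "zj x"])
  qed (use int in simp)
  also have "\<dots> = l2_inner \<Omega> (\<lambda>x. \<psi>' (yj x)) e - l2_inner \<Omega> (\<lambda>x. \<psi>' (zj x)) e"
    using int by (simp add: l2_inner_def)
  finally have 3: "- C\<^sub>\<psi> * (l2_norm \<Omega> e)\<^sup>2 \<le> \<dots>" .
  have "\<epsilon> / \<tau> * l2_inner \<Omega> (\<lambda>x. e x - (yp x - zp x)) e
      + \<epsilon> * (l2_inner \<Omega> (\<lambda>x. A' (weak_grad \<Omega> yj x)) (weak_grad \<Omega> e)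
        - l2_inner \<Omega> (\<lambda>x. B' (weak_grad \<Omega> zj x)) (weak_grad \<Omega> e))
      + 1 / \<epsilon> * (l2_inner \<Omega> (\<lambda>x. \<psi>' (yj x)) e - l2_inner \<Omega> (\<lambda>x. \<psi>' (zj x)) e) = 0"
    using eq_y eq_z unfolding 1 right_diff_distrib by linarith
  moreover have "\<epsilon> * (C\<^sub>A / 2 * (l2_norm \<Omega> g)\<^sup>2 - h\<^sup>2 / (2 * C\<^sub>A) * measure lebesgue \<Omega>)
      \<le> \<epsilon> * (l2_inner \<Omega> (\<lambda>x. A' (weak_grad \<Omega> yj x)) (weak_grad \<Omega> e)
        - l2_inner \<Omega> (\<lambda>x. B' (weak_grad \<Omega> zj x)) (weak_grad \<Omega> e))"
    using 2 \<open>\<epsilon> > 0\<close> by (intro mult_left_mono) auto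
  moreover have "1 / \<epsilon> * (- C\<^sub>\<psi> * (l2_norm \<Omega> e)\<^sup>2)
      \<le> 1 / \<epsilon> * (l2_inner \<Omega> (\<lambda>x. \<psi>' (yj x)) e - l2_inner \<Omega> (\<lambda>x. \<psi>' (zj x)) e)"
    using 3 \<open>\<epsilon> > 0\<close> by (intro mult_left_mono) auto
  ultimately show ?thesis by simp
qed

section \<open>Young's inequality and a discrete Gronwall lemma\<close>

text \<open>Integrates the nonnegative square of \<open>s * e x - f x\<close>. The weight
  \<open>s\<close> stays free so that \<open>implicit_step_bound\<close> can adapt it to the step
  size.\<close>

lemma l2_inner_young:
  fixes e f :: "'a::euclidean_space \<Rightarrow> real"
  assumes "e \<in> L2_space \<Omega>" "f \<in> L2_space \<Omega>" "s > 0"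
  shows "l2_inner \<Omega> (\<lambda>x. e x - f x) e \<ge> (1 - s / 2) * (l2_norm \<Omega> e)\<^sup>2 - (l2_norm \<Omega> f)\<^sup>2 / (2 * s)"
proof -
  have "(1 - s / 2) * (l2_norm \<Omega> e)\<^sup>2 - (l2_norm \<Omega> f)\<^sup>2 / (2 * s)
      = (LINT x|lebesgue_on \<Omega>. (1 - s / 2) * (norm (e x))\<^sup>2 - (norm (f x))\<^sup>2 / (2 * s))"
    using assms(1,2)[THEN in_L2_spaceD(2)] unfolding l2_norm_power2_eq_integral
    by (subst Bochner_Integration.integral_diff) auto
  also have "\<dots> \<le> (LINT x|lebesgue_on \<Omega>. (e x - f x) \<bullet> e x)"
  proof (rule integral_mono)
    show "integrable (lebesgue_on \<Omega>) (\<lambda>x. (1 - s / 2) * (norm (e x))\<^sup>2 - (norm (f x))\<^sup>2 / (2 * s))"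
      using assms(1,2)[THEN in_L2_spaceD(2)] by simp
    show "integrable (lebesgue_on \<Omega>) (\<lambda>x. (e x - f x) \<bullet> e x)"
      by (intro integrable_L2_inner L2_space_diff assms)
    fix x
    have "0 \<le> (s * e x - f x)\<^sup>2 / (2 * s)" using assms(3) by simp
    also have "\<dots> = s / 2 * (e x)\<^sup>2 + (f x)\<^sup>2 / (2 * s) - f x * e x"
      using assms(3) by (simp add: power2_eq_square field_simps)
    finally show "(1 - s / 2) * (norm (e x))\<^sup>2 - (norm (f x))\<^sup>2 / (2 * s) \<le> (e x - f x) \<bullet> e x"
      by (simp add: power2_eq_square algebra_simps)
  qed
  finally show ?thesis by (simp add: l2_inner_def)
qed

text \<open>The exponential step factors multiply up to \<open>exp (\<kappa> * t j)\<close>.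
  Nonnegativity of \<open>t j\<close> is carried through the induction because it makes this factor
  at least 1.\<close>

lemma discrete_gronwall:
  fixes S t :: "nat \<Rightarrow> real"
  assumes "S 0 \<le> 0" "t 0 = 0" "\<kappa> \<ge> 0" "D \<ge> 0"
    and mono: "\<And>j. j \<in> {1..N} \<Longrightarrow> t (j - 1) \<le> t j"
    and step: "\<And>j. j \<in> {1..N} \<Longrightarrow>
      S j \<le> exp (\<kappa> * (t j - t (j - 1))) * (S (j - 1) + D * (t j - t (j - 1)))"
  shows "j \<le> N \<Longrightarrow> 0 \<le> t j \<and> S j \<le> D * t j * exp (\<kappa> * t j)"
proof (induction j)
  case 0
  then show ?case using assms by simp
next
  case (Suc j)
  then have IH: "0 \<le> t j" "S j \<le> D * t j * exp (\<kappa> * t j)" and le: "t j \<le> t (Suc j)"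
    using mono[of "Suc j"] by auto
  let ?d = "t (Suc j) - t j"
  have "S (Suc j) \<le> exp (\<kappa> * ?d) * (S j + D * ?d)"
    using step[of "Suc j"] Suc.prems by simp
  \<comment> \<open>The new source term is enlarged by \<open>exp (\<kappa> * t j)\<close> so that
    it shares a factor with the accumulated one.\<close>
  also have "\<dots> \<le> exp (\<kappa> * ?d) * (D * t j * exp (\<kappa> * t j) + D * ?d * exp (\<kappa> * t j))"
  proof -
    have "1 \<le> exp (\<kappa> * t j)" using IH assms by simp
    then have "D * ?d * 1 \<le> D * ?d * exp (\<kappa> * t j)"
      using assms le by (intro mult_left_mono) auto
    then show ?thesis using IH by (intro mult_left_mono) auto
  qed
  also have "\<dots> = D * t (Suc j) * (exp (\<kappa> * ?d) * exp (\<kappa> * t j))"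
    by (simp add: algebra_simps)
  also have "exp (\<kappa> * ?d) * exp (\<kappa> * t j) = exp (\<kappa> * t (Suc j))"
    by (simp add: exp_add[symmetric] algebra_simps)
  finally show ?case using IH le by simp
qed

subsection \<open>Functions that are piecewise constant in time\<close>

lemma time_step_interval:
  assumes "time_partition T N t" "n \<le> N" "0 < s" "s \<le> t n"
  shows "\<exists>j\<in>{1..n}. s \<in> {t (j - 1)<..t j}"
  using assms(2-4)
proof (induction n)
  case 0
  then show ?case using assms(1) by (simp add: time_partition_def)
next
  case (Suc n)
  show ?case
  proof (cases "s \<le> t n")
    case True
    then obtain j where "j \<in> {1..n}" "s \<in> {t (j - 1)<..t j}" using Suc by auto
    then show ?thesis by (intro bexI[of _ j]) auto
  next
    case False
    then show ?thesis using Suc.prems by (intro bexI[of _ "Suc n"]) auto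
  qed
qed

lemma time_partition_mono:
  assumes "time_partition T N t" "i \<le> j" "j \<le> N"
  shows "t i \<le> t j"
  using assms(2,3)
proof (induction j rule: dec_induct)
  case (step j)
  then have "t j < t (Suc j)"
    using assms(1) unfolding time_partition_def by (metis Suc_eq_plus1 add_diff_cancel_right' atLeastAtMost_iff le_add2)
  with step show ?case by simp
qed simp

text \<open>The half-open intervals are disjoint and cover \<open>{0<..<T}\<close>, so exactly one
  summand survives. Measurability and integrals in time reduce to indicators.\<close>

lemma step_function_eq_sum:
  fixes F c :: "_ \<Rightarrow> real"
  assumes t: "time_partition T N t" and F: "\<And>j s. j \<in> {1..N} \<Longrightarrow> s \<in> {t (j - 1)<..t j} \<Longrightarrow> F s = c j"
    and s: "s \<in> {0<..<T}"
  shows "F s = (\<Sum>j\<in>{1..N}. indicator {t (j - 1)<..t j} s * c j)"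
proof -
  obtain j where j: "j \<in> {1..N}" "s \<in> {t (j - 1)<..t j}"
    using time_step_interval[OF t order_refl, of s] s t by (auto simp: time_partition_def)
  have "s \<notin> {t (i - 1)<..t i}" if i: "i \<in> {1..N} - {j}" for i
  proof (cases "i < j")
    case True
    then have "t i \<le> t (j - 1)" using j i by (intro time_partition_mono[OF t]) auto
    with j show ?thesis by auto
  next
    case False
    then have "t j \<le> t (i - 1)" using j i by (intro time_partition_mono[OF t]) auto
    with j show ?thesis by auto
  qed
  then have "(\<Sum>i\<in>{1..N} - {j}. indicator {t (i - 1)<..t i} s * c i) = 0"
    by (intro sum.neutral) auto
  moreover have "(\<Sum>i\<in>{1..N}. indicator {t (i - 1)<..t i} s * c i)
      = indicator {t (j - 1)<..t j} s * c j + (\<Sum>i\<in>{1..N} - {j}. indicator {t (i - 1)<..t i} s * c i)"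
    by (rule sum.remove[OF _ j(1)]) simp
  ultimately show ?thesis
    using F[OF j] j(2) by simp
qed

lemma step_function_measurable:
  fixes F c :: "_ \<Rightarrow> real"
  assumes "time_partition T N t" "\<And>j s. j \<in> {1..N} \<Longrightarrow> s \<in> {t (j - 1)<..t j} \<Longrightarrow> F s = c j"
  shows "F \<in> borel_measurable (lebesgue_on {0<..<T})"
proof (subst measurable_lebesgue_cong[OF step_function_eq_sum[OF assms]])
  show "(\<lambda>s. \<Sum>j\<in>{1..N}. indicator {t (j - 1)<..t j} s * c j) \<in> borel_measurable (lebesgue_on {0<..<T})"
    by (intro borel_measurable_sum borel_measurable_times borel_measurable_const
        measurable_restrict_space1 borel_measurable_indicator) auto
qed

text \<open>An upper bound suffices for the norm, so intersecting with \<open>{0<..<T}\<close>,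
  which cuts the endpoint \<open>T\<close> off the last interval, needs only monotonicity of
  measure.\<close>

lemma integral_step_function_le:
  fixes F c :: "_ \<Rightarrow> real"
  assumes t: "time_partition T N t" and F: "\<And>j s. j \<in> {1..N} \<Longrightarrow> s \<in> {t (j - 1)<..t j} \<Longrightarrow> F s = c j"
    and c: "\<And>j. j \<in> {1..N} \<Longrightarrow> c j \<ge> 0"
  shows "(LINT s|lebesgue_on {0<..<T}. F s) \<le> (\<Sum>j\<in>{1..N}. tau t j * c j)"
proof -
  let ?M = "lebesgue_on {0<..<T}"
  interpret finite_measure ?M
    by (rule finite_measure_lebesgue_on) simp
  have ind: "{t (j - 1)<..t j} \<inter> {0<..<T} \<in> sets ?M" for j
    by (auto simp: sets_restrict_space_iff)
  have "(LINT s|?M. F s) = (LINT s|?M. (\<Sum>j\<in>{1..N}. indicator ({t (j - 1)<..t j} \<inter> {0<..<T}) s * c j))"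
    by (intro Bochner_Integration.integral_cong refl)
       (subst step_function_eq_sum[OF t F], auto simp: indicator_def intro!: sum.cong)
  also have "\<dots> = (\<Sum>j\<in>{1..N}. measure ?M ({t (j - 1)<..t j} \<inter> {0<..<T}) * c j)"
    using ind by (subst Bochner_Integration.integral_sum) (auto simp: emeasure_finite less_top[symmetric])
  also have "\<dots> \<le> (\<Sum>j\<in>{1..N}. tau t j * c j)"
  proof (intro sum_mono mult_right_mono c)
    fix j assume j: "j \<in> {1..N}"
    then have le: "t (j - 1) \<le> t j" by (intro time_partition_mono[OF t]) auto
    have "measure ?M ({t (j - 1)<..t j} \<inter> {0<..<T}) = measure lebesgue ({t (j - 1)<..t j} \<inter> {0<..<T})"
      by (rule measure_restrict_space) auto
    also have "\<dots> \<le> measure lebesgue {t (j - 1)<..t j}"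
      by (rule measure_mono_fmeasurable) (auto intro!: bounded_set_imp_lmeasurable)
    also have "\<dots> = tau t j" using le by (simp add: tau_def)
    finally show "measure ?M ({t (j - 1)<..t j} \<inter> {0<..<T}) \<le> tau t j" .
  qed
  finally show ?thesis .
qed

subsection \<open>Stability of the scheme\<close>

text \<open>
  The usual weight \<open>s = 1\<close> in Young's inequality would require \<open>\<tau> < \<epsilon>\<^sup>2 / (2 C\<^sub>\<psi>)\<close>; the choice
  \<open>s = 1 - \<tau> C\<^sub>\<psi> / \<epsilon>\<^sup>2\<close> only needs \<open>\<tau> < \<epsilon>\<^sup>2 / C\<^sub>\<psi>\<close>.
\<close>
lemma implicit_step_bound:
  fixes a a' X G P D :: real
  assumes pos: "\<tau> > 0" "\<epsilon> > 0" "C\<^sub>A > 0" "C\<^sub>\<psi> \<ge> 0" "a' \<ge> 0" "G \<ge> 0" "D \<ge> 0" "P \<ge> 0"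
    and \<tau>: "\<tau> \<le> \<tau>max" "\<tau>max * C\<^sub>\<psi> < \<epsilon>\<^sup>2"
    and energy: "\<epsilon> / \<tau> * X + \<epsilon> * (C\<^sub>A / 2 * G - D / 2) - C\<^sub>\<psi> / \<epsilon> * a \<le> 0"
    and young: "\<And>s. s > 0 \<Longrightarrow> X \<ge> (1 - s / 2) * a - a' / (2 * s)"
  shows "a + C\<^sub>A * (P + \<tau> * G)
    \<le> exp (2 * (C\<^sub>\<psi> / (\<epsilon>\<^sup>2 - \<tau>max * C\<^sub>\<psi>)) * \<tau>) * (a' + C\<^sub>A * P + D * \<tau>)"
proof -
  define q s r where "q = \<tau> * C\<^sub>\<psi> / \<epsilon>\<^sup>2" and "s = 1 - q" and "r = 1 / s"
  let ?\<kappa> = "C\<^sub>\<psi> / (\<epsilon>\<^sup>2 - \<tau>max * C\<^sub>\<psi>)"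
  have le: "\<tau> * C\<^sub>\<psi> \<le> \<tau>max * C\<^sub>\<psi>" using \<tau> pos by (intro mult_right_mono)
  then have "q < 1" using \<tau> pos by (simp add: q_def)
  moreover have "q \<ge> 0" using pos by (simp add: q_def)
  ultimately have s: "s > 0" "s \<le> 1" by (auto simp: s_def)
  then have r: "r \<ge> 1" by (simp add: r_def)
  have "\<tau> / \<epsilon> * (\<epsilon> / \<tau> * X + \<epsilon> * (C\<^sub>A / 2 * G - D / 2) - C\<^sub>\<psi> / \<epsilon> * a) \<le> 0"
    by (rule mult_nonneg_nonpos[OF _ energy]) (use pos in simp)
  also have "\<tau> / \<epsilon> * (\<epsilon> / \<tau> * X + \<epsilon> * (C\<^sub>A / 2 * G - D / 2) - C\<^sub>\<psi> / \<epsilon> * a)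
      = X + \<tau> * (C\<^sub>A / 2 * G - D / 2) - q * a"
    using pos by (simp add: q_def field_simps power2_eq_square)
  finally have "(1 - s / 2) * a - a' / (2 * s) + \<tau> * (C\<^sub>A / 2 * G - D / 2) - q * a \<le> 0"
    using young[OF s(1)] by linarith
  \<comment> \<open>The coefficient of \<open>a\<close> is \<open>1 - s / 2 - q\<close>; this
    relation turns it into \<open>s / 2 > 0\<close>.\<close>
  moreover have q: "q = 1 - s" by (simp add: s_def)
  ultimately have "s / 2 * a + \<tau> * C\<^sub>A * G / 2 \<le> a' / (2 * s) + D * \<tau> / 2"
    unfolding q by (simp add: algebra_simps)
  \<comment> \<open>Multiplication by \<open>2 / s\<close> normalises the coefficient of
    \<open>a\<close> to 1 and turns that of \<open>a'\<close> into \<open>r\<^sup>2\<close>.\<close>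
  then have "2 * r * (s / 2 * a + \<tau> * C\<^sub>A * G / 2) \<le> 2 * r * (a' / (2 * s) + D * \<tau> / 2)"
    using r by (intro mult_left_mono) auto
  then have "a + r * (\<tau> * C\<^sub>A * G) \<le> r\<^sup>2 * a' + r * (D * \<tau>)"
    using s by (simp add: r_def power2_eq_square field_simps)
  \<comment> \<open>As \<open>r \<ge> 1\<close>, the gradient term on the left may lose its factor,
    while the source and the past gradient sum may gain \<open>r\<^sup>2\<close>; one factor then
    multiplies the whole previous state.\<close>
  moreover have "1 * (\<tau> * C\<^sub>A * G) \<le> r * (\<tau> * C\<^sub>A * G)"
    using r pos by (intro mult_right_mono) auto
  moreover have "r * (D * \<tau>) \<le> r\<^sup>2 * (D * \<tau>)"
    using r pos by (intro mult_right_mono) (auto intro: self_le_power)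
  moreover have "1 * (C\<^sub>A * P) \<le> r\<^sup>2 * (C\<^sub>A * P)"
    using r pos by (intro mult_right_mono) (auto simp: one_le_power)
  ultimately have "a + C\<^sub>A * (P + \<tau> * G) \<le> r\<^sup>2 * (a' + C\<^sub>A * P + D * \<tau>)"
    by (simp add: algebra_simps)
  also have "\<dots> \<le> exp (2 * ?\<kappa> * \<tau>) * (a' + C\<^sub>A * P + D * \<tau>)"
  proof (intro mult_right_mono)
    \<comment> \<open>Replacing \<tau> by \<open>\<tau>max\<close> in the denominator makes the
      growth rate the same for all steps; squaring \<open>r\<close> brings in the factor 2.\<close>
    have "r = 1 + q / s" using s by (simp add: r_def s_def field_simps)
    also have "q / s = \<tau> * C\<^sub>\<psi> / (\<epsilon>\<^sup>2 - \<tau> * C\<^sub>\<psi>)"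
      using pos by (simp add: q_def s_def field_simps)
    also have "\<dots> \<le> \<tau> * C\<^sub>\<psi> / (\<epsilon>\<^sup>2 - \<tau>max * C\<^sub>\<psi>)"
      using pos \<tau> le by (intro divide_left_mono mult_pos_pos) auto
    also have "\<dots> = ?\<kappa> * \<tau>" by simp
    also have "1 + ?\<kappa> * \<tau> \<le> exp (?\<kappa> * \<tau>)" by (rule exp_ge_add_one_self)
    finally have "r \<le> exp (?\<kappa> * \<tau>)" by simp
    then have "r\<^sup>2 \<le> (exp (?\<kappa> * \<tau>))\<^sup>2" using r by (intro power_mono) auto
    also have "\<dots> = exp (2 * ?\<kappa> * \<tau>)" by (simp add: exp_double[symmetric] mult.assoc)
    finally show "r\<^sup>2 \<le> exp (2 * ?\<kappa> * \<tau>)" .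
  qed (use pos in auto)
  finally show ?thesis .
qed

text \<open>One functional \<open>S\<close> holds the squared error and the accumulated gradient
  error. Gronwall bounds it at every step: each step yields the first claim, the last step the
  second.\<close>

lemma scheme_difference_bounds:
  fixes \<Omega> :: "'a::euclidean_space set" and t :: "nat \<Rightarrow> real"
  assumes \<Omega>: "open \<Omega>" "bounded \<Omega>" and "\<epsilon> > 0" and t: "time_partition T N t"
    and A: "assm_A C\<^sub>A A A'" and B: "assm_A C\<^sub>A B B'" and \<psi>: "assm_psi C\<^sub>\<psi> \<psi> \<psi>'"
    and AB: "\<And>p. norm (B' p - A' p) \<le> h" and y0: "y0 \<in> H1_space \<Omega>"
    and \<tau>: "\<And>j. j \<in> {1..N} \<Longrightarrow> tau t j \<le> \<tau>max" "\<tau>max * C\<^sub>\<psi> < \<epsilon>\<^sup>2"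
    and y: "solves_scheme \<Omega> \<epsilon> N t A' \<psi>' y0 u y" and z: "solves_scheme \<Omega> \<epsilon> N t B' \<psi>' y0 u z"
  defines "M \<equiv> measure lebesgue \<Omega> / C\<^sub>A * T * exp (2 * (C\<^sub>\<psi> / (\<epsilon>\<^sup>2 - \<tau>max * C\<^sub>\<psi>)) * T)"
  shows "j \<in> {1..N} \<Longrightarrow> (l2_norm \<Omega> (\<lambda>x. y (t j) x - z (t j) x))\<^sup>2 \<le> h\<^sup>2 * M"
    and "C\<^sub>A * (\<Sum>j\<in>{1..N}. tau t j * (l2_norm \<Omega> (\<lambda>x. weak_grad \<Omega> (y (t j)) x - weak_grad \<Omega> (z (t j)) x))\<^sup>2)
      \<le> h\<^sup>2 * M"
proof -
  \<comment> \<open>Twice the perturbation term of \<open>energy_estimate\<close>, matching the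
    \<open>D / 2\<close> in \<open>implicit_step_bound\<close>.\<close>
  define D where "D = h\<^sup>2 / C\<^sub>A * measure lebesgue \<Omega>"
  define \<kappa> where "\<kappa> = 2 * (C\<^sub>\<psi> / (\<epsilon>\<^sup>2 - \<tau>max * C\<^sub>\<psi>))"
  define yv zv where "yv = step_value y0 t y" and "zv = step_value y0 t z"
  define e g where "e j x = yv j x - zv j x" and "g j x = weak_grad \<Omega> (yv j) x - weak_grad \<Omega> (zv j) x" for j x
  define P where "P n = (\<Sum>j\<in>{1..n}. tau t j * (l2_norm \<Omega> (g j))\<^sup>2)" for n
  define S where "S j = (l2_norm \<Omega> (e j))\<^sup>2 + C\<^sub>A * P j" for j
  have CA: "C\<^sub>A > 0" using A by (simp add: assm_A_def)
  have C\<psi>: "C\<^sub>\<psi> \<ge> 0" using \<psi> by (simp add: assm_psi_def)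
  have D: "D \<ge> 0" using CA by (simp add: D_def)
  have \<kappa>: "\<kappa> \<ge> 0" using C\<psi> \<tau>(2) by (simp add: \<kappa>_def)
  have tau_pos: "tau t j > 0" if "j \<in> {1..N}" for j
    using t that by (simp add: time_partition_def tau_def)
  have P_nonneg: "P n \<ge> 0" if "n \<le> N" for n
    unfolding P_def using that tau_pos by (intro sum_nonneg mult_nonneg_nonneg) (auto intro!: less_imp_le)
  have H1: "yv j \<in> H1_space \<Omega>" "zv j \<in> H1_space \<Omega>" if "j \<le> N" for j
    using y z y0 that
    by (auto simp: yv_def zv_def step_value_def solves_scheme_def Y_space_def step_space_def)
  have eH: "e j \<in> H1_space \<Omega>" if "j \<le> N" for j
    unfolding e_def[abs_def] using H1[OF that] \<Omega> by (intro H1_space_diff) auto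
  have step: "S j \<le> exp (\<kappa> * (t j - t (j - 1))) * (S (j - 1) + D * (t j - t (j - 1)))"
    if j: "j \<in> {1..N}" for j
  proof -
    let ?X = "l2_inner \<Omega> (\<lambda>x. e j x - e (j - 1) x) (e j)"
    have jN: "j \<le> N" "j - 1 \<le> N" using j by auto
    note eqs = y[unfolded solves_scheme_def Let_def, THEN conjunct2, rule_format, OF j eH[OF jN(1)], folded yv_def]
      z[unfolded solves_scheme_def Let_def, THEN conjunct2, rule_format, OF j eH[OF jN(1)], folded zv_def]
    have D2: "D / 2 = h\<^sup>2 / (2 * C\<^sub>A) * measure lebesgue \<Omega>" by (simp add: D_def)
    have energy: "\<epsilon> / tau t j * ?X + \<epsilon> * (C\<^sub>A / 2 * (l2_norm \<Omega> (g j))\<^sup>2 - D / 2)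
        - C\<^sub>\<psi> / \<epsilon> * (l2_norm \<Omega> (e j))\<^sup>2 \<le> 0"
      unfolding D2
      by (rule energy_estimate[OF \<Omega> \<open>\<epsilon> > 0\<close> CA H1(1)[OF jN(1)] H1(1)[OF jN(2)] H1(2)[OF jN(1)] H1(2)[OF jN(2)]
          A B \<psi> AB, folded e_def g_def, OF eqs(1)[THEN conjunct1] eqs(2)[THEN conjunct1]
          eqs(1)[THEN conjunct2] eqs(2)[THEN conjunct2]])
    have young: "?X \<ge> (1 - s / 2) * (l2_norm \<Omega> (e j))\<^sup>2 - (l2_norm \<Omega> (e (j - 1)))\<^sup>2 / (2 * s)"
      if "s > 0" for s
      using that by (rule l2_inner_young[OF eH[OF jN(1), THEN H1_space_imp_L2] eH[OF jN(2), THEN H1_space_imp_L2]])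
    have "(l2_norm \<Omega> (e j))\<^sup>2 + C\<^sub>A * (P (j - 1) + tau t j * (l2_norm \<Omega> (g j))\<^sup>2)
        \<le> exp (\<kappa> * tau t j) * ((l2_norm \<Omega> (e (j - 1)))\<^sup>2 + C\<^sub>A * P (j - 1) + D * tau t j)"
      unfolding \<kappa>_def
      by (rule implicit_step_bound[OF tau_pos[OF j] \<open>\<epsilon> > 0\<close> CA C\<psi> _ _ D P_nonneg[OF jN(2)]
            \<tau>(1)[OF j] \<tau>(2) energy young]) auto
    moreover have "P j = P (j - 1) + tau t j * (l2_norm \<Omega> (g j))\<^sup>2"
      using j by (cases j) (auto simp: P_def)
    ultimately show ?thesis by (simp add: S_def tau_def)
  qed
  \<comment> \<open>Both schemes start from \<open>y0\<close>, and \<open>P 0\<close> is an empty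
    sum.\<close>
  have "e 0 = (\<lambda>x. 0)" by (simp add: e_def[abs_def] yv_def zv_def step_value_def)
  then have S0: "S 0 \<le> 0"
    by (simp add: S_def P_def l2_norm_def l2_inner_def)
  have bound: "S j \<le> h\<^sup>2 * M" if "j \<le> N" for j
  proof -
    have t0: "t 0 = 0" "t N = T" using t by (auto simp: time_partition_def)
    have "0 \<le> t j" "S j \<le> D * t j * exp (\<kappa> * t j)"
      using discrete_gronwall[where S = S and t = t and N = N and j = j, OF S0 t0(1) \<kappa> D _ step \<open>j \<le> N\<close>]
        time_partition_mono[OF t] by auto
    moreover have "t j \<le> T" using time_partition_mono[OF t \<open>j \<le> N\<close>] t0 by simp
    ultimately have "S j \<le> D * T * exp (\<kappa> * T)"
      using \<kappa> D by (elim order.trans) (intro mult_mono mult_nonneg_nonneg, auto intro: mult_left_mono)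
    also have "\<dots> = h\<^sup>2 * M" by (simp add: M_def D_def \<kappa>_def)
    finally show ?thesis .
  qed
  have val: "yv j = y (t j)" "zv j = z (t j)" if "j \<in> {1..N}" for j
    using that by (auto simp: yv_def zv_def step_value_def)
  show "(l2_norm \<Omega> (\<lambda>x. y (t j) x - z (t j) x))\<^sup>2 \<le> h\<^sup>2 * M" if "j \<in> {1..N}" for j
  proof -
    have "(l2_norm \<Omega> (e j))\<^sup>2 \<le> S j"
      using P_nonneg[of j] that CA by (simp add: S_def)
    also have "\<dots> \<le> h\<^sup>2 * M" using bound[of j] that by simp
    finally show ?thesis by (simp add: e_def[abs_def] val[OF that])
  qed
  have "C\<^sub>A * P N \<le> S N" by (simp add: S_def)
  also have "\<dots> \<le> h\<^sup>2 * M" by (rule bound) simp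
  also have "P N = (\<Sum>j\<in>{1..N}. tau t j * (l2_norm \<Omega> (\<lambda>x. weak_grad \<Omega> (y (t j)) x - weak_grad \<Omega> (z (t j)) x))\<^sup>2)"
    unfolding P_def by (intro sum.cong refl) (simp add: g_def[abs_def] val)
  finally show "C\<^sub>A * (\<Sum>j\<in>{1..N}. tau t j * (l2_norm \<Omega> (\<lambda>x. weak_grad \<Omega> (y (t j)) x - weak_grad \<Omega> (z (t j)) x))\<^sup>2)
      \<le> h\<^sup>2 * M" .
qed

section \<open>From grid values to space-time norms\<close>

text \<open>Members of \<open>Y_space\<close> are constant in time only up to null sets of \<Omega>.
  Norms do not see this, and the chosen weak gradients are even identical.\<close>

lemma Y_space_L2_difference:
  assumes "y \<in> Y_space \<Omega> N t" "z \<in> Y_space \<Omega> N t" "j \<in> {1..N}" "s \<in> {t (j - 1)<..t j}"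
    and \<Omega>: "bounded \<Omega>" "\<Omega> \<in> sets lebesgue"
  shows "l2_norm \<Omega> (\<lambda>x. y s x - z s x) = l2_norm \<Omega> (\<lambda>x. y (t j) x - z (t j) x)"
    and "weak_grad \<Omega> (y s) = weak_grad \<Omega> (y (t j))" "weak_grad \<Omega> (z s) = weak_grad \<Omega> (z (t j))"
proof -
  have H1: "y (t j) \<in> H1_space \<Omega>" "z (t j) \<in> H1_space \<Omega>"
    and ae: "AE x in lebesgue_on \<Omega>. y s x = y (t j) x" "AE x in lebesgue_on \<Omega>. z s x = z (t j) x"
    using assms by (auto simp: Y_space_def step_space_def)
  have e: "(\<lambda>x. y (t j) x - z (t j) x) \<in> L2_space \<Omega>"
    using H1 by (intro L2_space_diff H1_space_imp_L2)
  have "AE x in lebesgue_on \<Omega>. y (t j) x - z (t j) x = y s x - z s x"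
    using ae by eventually_elim simp
  then show "l2_norm \<Omega> (\<lambda>x. y s x - z s x) = l2_norm \<Omega> (\<lambda>x. y (t j) x - z (t j) x)"
    unfolding l2_norm_def using l2_inner_cong_AE[OF e e \<Omega>(2)] by simp
  show "weak_grad \<Omega> (y s) = weak_grad \<Omega> (y (t j))" "weak_grad \<Omega> (z s) = weak_grad \<Omega> (z (t j))"
    using weak_grad_cong_AE ae \<Omega> by blast+
qed

lemma LinfL2_norm_step_le:
  assumes t: "time_partition T N t"
    and v: "\<And>j s. j \<in> {1..N} \<Longrightarrow> s \<in> {t (j - 1)<..t j} \<Longrightarrow> l2_norm \<Omega> (v s) = c j"
    and c: "\<And>j. j \<in> {1..N} \<Longrightarrow> c j \<le> b"
  shows "LinfL2_norm T \<Omega> v \<le> ereal b"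
  unfolding LinfL2_norm_def
proof (rule esssup_I)
  \<comment> \<open>\<open>esssup\<close> of a non-measurable function is \<open>top\<close> by
    convention, so measurability in time has to be shown.\<close>
  have "(\<lambda>s. l2_norm \<Omega> (v s)) \<in> borel_measurable (lebesgue_on {0<..<T})"
    using v by (rule step_function_measurable[OF t])
  then show "(\<lambda>s. ereal (l2_norm \<Omega> (v s))) \<in> borel_measurable (lebesgue_on {0<..<T})"
    by (rule borel_measurable_ereal)
  show "AE s in lebesgue_on {0<..<T}. ereal (l2_norm \<Omega> (v s)) \<le> ereal b"
  proof (rule AE_I2)
    fix s assume "s \<in> space (lebesgue_on {0<..<T})"
    then obtain j where "j \<in> {1..N}" "s \<in> {t (j - 1)<..t j}"
      using time_step_interval[OF t order_refl, of s] t by (auto simp: time_partition_def)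
    then show "ereal (l2_norm \<Omega> (v s)) \<le> ereal b" using v c by simp
  qed
qed

lemma L2L2_norm_step_le:
  assumes t: "time_partition T N t"
    and v: "\<And>j s. j \<in> {1..N} \<Longrightarrow> s \<in> {t (j - 1)<..t j} \<Longrightarrow> l2_norm \<Omega> (v s) = c j"
  shows "L2L2_norm T \<Omega> v \<le> sqrt (\<Sum>j\<in>{1..N}. tau t j * (c j)\<^sup>2)"
  unfolding L2L2_norm_def using v
  by (intro real_sqrt_le_mono integral_step_function_le[OF t]) auto

text \<open>Quantifying \<open>C\<close> before the partition, the nonlinearities, the data and
  \<delta> expresses that it depends only on the parameters fixed outside.\<close>

theorem theorem3p1:
  fixes \<Omega> :: "'a::euclidean_space set" and T \<epsilon> C\<^sub>A C\<^sub>\<psi> \<tau>max :: real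
  assumes "lipschitz_domain \<Omega>" and "bounded \<Omega>" and "T > 0" and "\<epsilon> > 0"
  shows "\<exists>C::real.
    \<forall>(N::nat) (t :: nat \<Rightarrow> real) (A :: 'a \<Rightarrow> real) (A' :: 'a \<Rightarrow> 'a)
      (\<psi> :: real \<Rightarrow> real) (\<psi>' :: real \<Rightarrow> real) (y0 :: 'a \<Rightarrow> real)
      (A\<^sub>\<delta> :: real \<Rightarrow> 'a \<Rightarrow> real) (A\<^sub>\<delta>' :: real \<Rightarrow> 'a \<Rightarrow> 'a) (\<eta> :: real \<Rightarrow> real)
      (u :: real \<Rightarrow> 'a \<Rightarrow> real) (y :: real \<Rightarrow> 'a \<Rightarrow> real) (y\<^sub>\<delta> :: real \<Rightarrow> real \<Rightarrow> 'a \<Rightarrow> real).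
      time_partition T N t \<and>
      Max (tau t ` {1..N}) = \<tau>max \<and>
      assm_A C\<^sub>A A A' \<and>
      assm_psi C\<^sub>\<psi> \<psi> \<psi>' \<and>
      y0 \<in> H1_space \<Omega> \<and> integrable (lebesgue_on \<Omega>) (\<lambda>x. \<psi> (y0 x)) \<and>
      (C\<^sub>\<psi> > 0 \<longrightarrow> \<tau>max < \<epsilon>\<^sup>2 / C\<^sub>\<psi>) \<and>
      (\<forall>\<delta>>0. assm_A C\<^sub>A (A\<^sub>\<delta> \<delta>) (A\<^sub>\<delta>' \<delta>)) \<and>
      (\<forall>\<delta>>0. \<eta> \<delta> \<ge> 0) \<and>
      (\<forall>\<delta>>0. \<forall>p. norm (A\<^sub>\<delta>' \<delta> p - A' p) \<le> \<eta> \<delta>) \<and>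
      u \<in> U_space \<Omega> N t \<and>
      solves_scheme \<Omega> \<epsilon> N t A' \<psi>' y0 u y \<and>
      (\<forall>\<delta>>0. solves_scheme \<Omega> \<epsilon> N t (A\<^sub>\<delta>' \<delta>) \<psi>' y0 u (y\<^sub>\<delta> \<delta>))
      \<longrightarrow>
      (\<forall>\<delta>>0.
        LinfL2_norm T \<Omega> (\<lambda>s x. y s x - y\<^sub>\<delta> \<delta> s x)
          + ereal (L2L2_norm T \<Omega> (\<lambda>s x. weak_grad \<Omega> (y s) x - weak_grad \<Omega> (y\<^sub>\<delta> \<delta> s) x))
        \<le> ereal (C * \<eta> \<delta>))"
proof -
  have \<Omega>: "open \<Omega>" "bounded \<Omega>"
    using assms by (auto simp: lipschitz_domain_def)
  then have \<Omega>_sets: "\<Omega> \<in> sets lebesgue" by auto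
  \<comment> \<open>The Gronwall bound at time \<open>T\<close> with the squared perturbation
    factored out.\<close>
  define M where "M = measure lebesgue \<Omega> / C\<^sub>A * T * exp (2 * (C\<^sub>\<psi> / (\<epsilon>\<^sup>2 - \<tau>max * C\<^sub>\<psi>)) * T)"
  show ?thesis
  \<comment> \<open>The summands belong to the two norms; the second divides by
    \<open>C\<^sub>A\<close> because the accumulated gradient error carries that weight.\<close>
  proof (intro exI[of _ "sqrt M + sqrt (M / C\<^sub>A)"] allI impI; elim conjE)
    fix N :: nat and t :: "nat \<Rightarrow> real" and A :: "'a \<Rightarrow> real" and A' :: "'a \<Rightarrow> 'a"
      and \<psi> \<psi>' :: "real \<Rightarrow> real" and y0 :: "'a \<Rightarrow> real" and A\<^sub>\<delta> :: "real \<Rightarrow> 'a \<Rightarrow> real"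
      and A\<^sub>\<delta>' :: "real \<Rightarrow> 'a \<Rightarrow> 'a" and \<eta> :: "real \<Rightarrow> real" and u y :: "real \<Rightarrow> 'a \<Rightarrow> real"
      and y\<^sub>\<delta> :: "real \<Rightarrow> real \<Rightarrow> 'a \<Rightarrow> real" and \<delta> :: real
    assume t: "time_partition T N t" and Max: "Max (tau t ` {1..N}) = \<tau>max"
      and A: "assm_A C\<^sub>A A A'" and \<psi>: "assm_psi C\<^sub>\<psi> \<psi> \<psi>'" and y0: "y0 \<in> H1_space \<Omega>"
      and \<tau>max: "C\<^sub>\<psi> > 0 \<longrightarrow> \<tau>max < \<epsilon>\<^sup>2 / C\<^sub>\<psi>" and "\<delta> > 0"
      and "\<forall>\<delta>>0. assm_A C\<^sub>A (A\<^sub>\<delta> \<delta>) (A\<^sub>\<delta>' \<delta>)" "\<forall>\<delta>>0. \<eta> \<delta> \<ge> 0"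
      and "\<forall>\<delta>>0. \<forall>p. norm (A\<^sub>\<delta>' \<delta> p - A' p) \<le> \<eta> \<delta>"
      and y: "solves_scheme \<Omega> \<epsilon> N t A' \<psi>' y0 u y"
      and "\<forall>\<delta>>0. solves_scheme \<Omega> \<epsilon> N t (A\<^sub>\<delta>' \<delta>) \<psi>' y0 u (y\<^sub>\<delta> \<delta>)"
    then have B: "assm_A C\<^sub>A (A\<^sub>\<delta> \<delta>) (A\<^sub>\<delta>' \<delta>)" and \<eta>: "\<eta> \<delta> \<ge> 0"
      and AB: "\<And>p. norm (A\<^sub>\<delta>' \<delta> p - A' p) \<le> \<eta> \<delta>"
      and z: "solves_scheme \<Omega> \<epsilon> N t (A\<^sub>\<delta>' \<delta>) \<psi>' y0 u (y\<^sub>\<delta> \<delta>)"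
      by auto
    have CA: "C\<^sub>A > 0" using A by (simp add: assm_A_def)
    have C\<psi>: "C\<^sub>\<psi> \<ge> 0" using \<psi> by (simp add: assm_psi_def)
    have \<tau>1: "tau t j \<le> \<tau>max" if "j \<in> {1..N}" for j
      using that unfolding Max[symmetric] by (intro Max_ge) auto
    \<comment> \<open>The product form of the step restriction also covers
      \<open>C\<^sub>\<psi> = 0\<close>, where it reads
      \<open>0 < \<epsilon>\<^sup>2\<close>.\<close>
    have \<tau>2: "\<tau>max * C\<^sub>\<psi> < \<epsilon>\<^sup>2"
      using \<tau>max C\<psi> \<open>\<epsilon> > 0\<close> by (cases "C\<^sub>\<psi> = 0") (auto simp: pos_less_divide_eq)
    note bounds = scheme_difference_bounds[OF \<Omega> \<open>\<epsilon> > 0\<close> t A B \<psi> AB y0 \<tau>1 \<tau>2 y z, folded M_def]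
    have Y: "y \<in> Y_space \<Omega> N t" "y\<^sub>\<delta> \<delta> \<in> Y_space \<Omega> N t"
      using y z by (auto simp: solves_scheme_def)
    note const = Y_space_L2_difference[OF Y _ _ \<Omega>(2) \<Omega>_sets]
    have "LinfL2_norm T \<Omega> (\<lambda>s x. y s x - y\<^sub>\<delta> \<delta> s x) \<le> ereal (sqrt M * \<eta> \<delta>)"
    proof (rule LinfL2_norm_step_le[OF t])
      show "l2_norm \<Omega> (\<lambda>x. y s x - y\<^sub>\<delta> \<delta> s x) = l2_norm \<Omega> (\<lambda>x. y (t j) x - y\<^sub>\<delta> \<delta> (t j) x)"
        if "j \<in> {1..N}" "s \<in> {t (j - 1)<..t j}" for j s
        using that by (rule const(1))
      fix j assume "j \<in> {1..N}"
      then have "sqrt ((l2_norm \<Omega> (\<lambda>x. y (t j) x - y\<^sub>\<delta> \<delta> (t j) x))\<^sup>2) \<le> sqrt ((\<eta> \<delta>)\<^sup>2 * M)"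
        by (intro real_sqrt_le_mono bounds)
      then show "l2_norm \<Omega> (\<lambda>x. y (t j) x - y\<^sub>\<delta> \<delta> (t j) x) \<le> sqrt M * \<eta> \<delta>"
        using \<eta> by (simp add: l2_norm_nonneg real_sqrt_mult mult.commute)
    qed
    moreover have "L2L2_norm T \<Omega> (\<lambda>s x. weak_grad \<Omega> (y s) x - weak_grad \<Omega> (y\<^sub>\<delta> \<delta> s) x)
        \<le> sqrt (M / C\<^sub>A) * \<eta> \<delta>"
    proof -
      let ?c = "\<lambda>j. l2_norm \<Omega> (\<lambda>x. weak_grad \<Omega> (y (t j)) x - weak_grad \<Omega> (y\<^sub>\<delta> \<delta> (t j)) x)"
      have "L2L2_norm T \<Omega> (\<lambda>s x. weak_grad \<Omega> (y s) x - weak_grad \<Omega> (y\<^sub>\<delta> \<delta> s) x)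
          \<le> sqrt (\<Sum>j\<in>{1..N}. tau t j * (?c j)\<^sup>2)"
      proof (rule L2L2_norm_step_le[OF t])
        fix j s assume js: "j \<in> {1..N}" "s \<in> {t (j - 1)<..t j}"
        show "l2_norm \<Omega> (\<lambda>x. weak_grad \<Omega> (y s) x - weak_grad \<Omega> (y\<^sub>\<delta> \<delta> s) x) = ?c j"
          unfolding const(2)[OF js] const(3)[OF js] ..
      qed
      also have "\<dots> \<le> sqrt ((\<eta> \<delta>)\<^sup>2 * (M / C\<^sub>A))"
        using bounds(2) CA by (intro real_sqrt_le_mono) (simp add: field_simps)
      also have "\<dots> = sqrt (M / C\<^sub>A) * \<eta> \<delta>"
        unfolding real_sqrt_mult using \<eta> by simp
      finally show ?thesis .
    qed
    ultimately have "LinfL2_norm T \<Omega> (\<lambda>s x. y s x - y\<^sub>\<delta> \<delta> s x)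
        + ereal (L2L2_norm T \<Omega> (\<lambda>s x. weak_grad \<Omega> (y s) x - weak_grad \<Omega> (y\<^sub>\<delta> \<delta> s) x))
      \<le> ereal (sqrt M * \<eta> \<delta>) + ereal (sqrt (M / C\<^sub>A) * \<eta> \<delta>)"
      by (intro add_mono) auto
    then show "LinfL2_norm T \<Omega> (\<lambda>s x. y s x - y\<^sub>\<delta> \<delta> s x)
        + ereal (L2L2_norm T \<Omega> (\<lambda>s x. weak_grad \<Omega> (y s) x - weak_grad \<Omega> (y\<^sub>\<delta> \<delta> s) x))
      \<le> ereal ((sqrt M + sqrt (M / C\<^sub>A)) * \<eta> \<delta>)"
      by (simp add: distrib_right)
  qed
qed

end
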